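(* Let $D$ be an effective divisor on a metric graph $\Gamma$ and let $(D,\Sigma)$ be a tropical linear series of rank $r$. Then $(D,\Sigma)$ is structured, i.e. $\Sigma\subseteq R(\mathfrak S)$ for some $r$-slope structure $\mathfrak S$, if and only if $(D,\Sigma)$ is a combinatorial limit linear series of rank $r$.
   Context: Metric graphs and functions. A metric graph is obtained from a finite connected graph by identifying each edge with a closed interval of positive length. $T_v(\Gamma)$ is the set of outgoing tangent directions and $\mathrm{val}(v)=|T_v(\Gamma)|$. $\mathrm{PL}(\Gamma)$ is the set of continuous piecewise linear functions with integer slopes, and $\mathrm{sl}_\eta(f)$ is the outgoing slope along $\eta$. We set $\mathrm{div}(f)=\sum_v(-\sum_{\eta\in T_v}\mathrm{sl}_\eta(f))v$ and $R(D)=\{f:D+\mathrm{div}(f)\ge0\}$. $\mathrm{PL}(\Gamma)$ carries the sup-norm topology. Tropical linear series. A tropical linear series of rank $r$ is $(D,\Sigma)$ with $\Sigma\subseteq R(D)$ a finitely generated tropical submodule (closed under $\min\{f_i+a_i\}$, $a_i\in\mathbb R$) such that: (1) every effective $E$ of degree $r$ admits $f\in\Sigma$ with $\mathrm{div}(f)+D\ge E$; (2) every $r+2$ functions of $\Sigma$ are tropically dependent (some $\min_i(f_i+a_i)$ is attained at least twice at every point). Permutation arrays. $[r]=\{0,\dots,r\}$, and $[r]^d$ is ordered coordinatewise with meet $\wedge$ the coordinatewise minimum. $P\subseteq[r]^d$ is rankable of rank $s$ if each coordinate takes exactly $s+1$ values on $P$. It is totally rankable if each $P[\mathbf x]=\{\mathbf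 y\in P:\mathbf y\succeq\mathbf x\}$ is rankable, with rank array $\rho_P(\mathbf x)=\mathrm{rank}\,P[\mathbf x]$. Redundant points are $\bigwedge\mathcal H$ for $\mathcal H\subseteq P$, $|\mathcal H|\ge2$, each member sharing a coordinate with the point. A permutation array of rank $r$, dimension $d$ is a totally rankable $P$ of rank $r$ with no redundant points. $\overline P$ adds the redundant points. The standard one is $\{\mathbf x:\sum x_i=r\}$. Slope structures. Let $V\subset\Gamma$ be finite, containing all points of valence $\ne2$. An $r$-slope structure $\mathfrak S$ assigns: - integers $s^\eta_0<\dots<s^\eta_r$ to each tangent vector $\eta$; - an ordering $\eta_1,\dots,\eta_{\mathrm{val}(v)}$ of $T_v(\Gamma)$ to each $v$; - a permutation array $P_v$ of rank $r$ and dimension $\mathrm{val}(v)$ to each $v$. It must satisfy: - on each component of $\Gamma\setminus V$, $S^\eta$ is constant in each direction, and $s^\eta_i+s^\xi_{r-i}=0$ for opposite directions; - $P_v$ is standard for $v\notin V$. $f$ is compatible with $\mathfrak S$ if all $\mathrm{sl}_\eta(f)\in S^\eta$ and each index vector $\partial_v(f)$, defined by $\mathrm{sl}_{\eta_k}(f)=s^{\eta_k}_{\partial_v(f)_k}$, lies in $\overline{P_v}$. Then $\rho_v(f)=\rho_{P_v}(\partial_v(f))$. $R(\mathfrak S)$ is the set of compatible functions and $R(D,\mathfrak S)=R(D)\cap R(\mathfrak S)$. Combinatorial limit linear series. $f$ satisfies (BNRP) for effective $E$ if $\mathrm{div}(f)+D\ge E$, and (LRP) if $\rho_v(f)\ge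 E(v)$ for all $v$. A tropical submodule $\Sigma\subseteq R(D)$ is admissible of rank $r$ if: - it is closed in the sup-norm topology; - $\Sigma\subseteq R(D,\mathfrak S)$ for an $r$-slope structure $\mathfrak S$; - every effective $E$ of degree $r$ admits $f\in\Sigma$ satisfying (BNRP) and (LRP) for $E$ relative to $\mathfrak S$. A combinatorial limit linear series of rank $r$ is $(D,\Sigma)$ with $\Sigma$ finitely generated, admissible of rank $r$, and every $r+2$ elements tropically dependent. *)

theory Defs
  imports Complex_Main
begin

record ('v, 'e) mgraph =
  verts :: "'v set"
  edges :: "'e set"
  src :: "'e \<Rightarrow> 'v"
  tgt :: "'e \<Rightarrow> 'v"
  elen :: "'e \<Rightarrow> real"

datatype ('v, 'e) pt = Vt 'v | In 'e real

type_synonym 'e tangent = "'e \<times> real \<times> bool"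

definition adj :: "('v,'e) mgraph \<Rightarrow> 'v \<Rightarrow> 'v \<Rightarrow> bool" where
  "adj G u w \<longleftrightarrow> (\<exists>e\<in>edges G. (src G e = u \<and> tgt G e = w) \<or> (src G e = w \<and> tgt G e = u))"

definition wf_mgraph :: "('v,'e) mgraph \<Rightarrow> bool" where
  "wf_mgraph G \<longleftrightarrow> finite (verts G) \<and> finite (edges G) \<and> edges G \<noteq> {} \<and>
     (\<forall>e\<in>edges G. src G e \<in> verts G \<and> tgt G e \<in> verts G \<and> elen G e > 0) \<and>
     (\<forall>u\<in>verts G. \<forall>w\<in>verts G. (adj G)\<^sup>*\<^sup>* u w)"

definition pts :: "('v,'e) mgraph \<Rightarrow> ('v,'e) pt set" where
  "pts G = Vt ` verts G \<union> {In e t | e t. e \<in> edges G \<and> 0 < t \<and> t < elen G e}"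

definition epar :: "('v,'e) mgraph \<Rightarrow> 'e \<Rightarrow> real \<Rightarrow> ('v,'e) pt" where
  "epar G e t = (if t \<le> 0 then Vt (src G e) else if elen G e \<le> t then Vt (tgt G e) else In e t)"

text \<open>Tangent vector (e,t,b): based at epar G e t, pointing towards increasing (b) or
  decreasing (not b) parameter along e.\<close>
definition tangents :: "('v,'e) mgraph \<Rightarrow> 'e tangent set" where
  "tangents G = {(e,t,b). e \<in> edges G \<and> (if b then 0 \<le> t \<and> t < elen G e else 0 < t \<and> t \<le> elen G e)}"

definition Tv :: "('v,'e) mgraph \<Rightarrow> ('v,'e) pt \<Rightarrow> 'e tangent set" where
  "Tv G x = {\<eta> \<in> tangents G. epar G (fst \<eta>) (fst (snd \<eta>)) = x}"

definition val :: "('v,'e) mgraph \<Rightarrow> ('v,'e) pt \<Rightarrow> nat" where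
  "val G x = card (Tv G x)"

definition sl :: "('v,'e) mgraph \<Rightarrow> (('v,'e) pt \<Rightarrow> real) \<Rightarrow> 'e tangent \<Rightarrow> real" where
  "sl G f \<eta> = (case \<eta> of (e,t,b) \<Rightarrow>
     Lim (at_right 0) (\<lambda>h. (f (epar G e (if b then t + h else t - h)) - f (epar G e t)) / h))"

definition PL :: "('v,'e) mgraph \<Rightarrow> (('v,'e) pt \<Rightarrow> real) set" where
  "PL G = {f. (\<forall>x. x \<notin> pts G \<longrightarrow> f x = 0) \<and>
     (\<forall>e\<in>edges G. \<exists>(a::nat \<Rightarrow> real) (k::nat) (m::nat \<Rightarrow> int).
        a 0 = 0 \<and> a k = elen G e \<and> (\<forall>i<k. a i < a (Suc i)) \<and>
        (\<forall>i<k. \<forall>s\<in>{a i..a (Suc i)}. f (epar G e s) = f (epar G e (a i)) + of_int (m i) * (s - a i)))}"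

definition divf :: "('v,'e) mgraph \<Rightarrow> (('v,'e) pt \<Rightarrow> real) \<Rightarrow> ('v,'e) pt \<Rightarrow> real" where
  "divf G f x = - (\<Sum>\<eta>\<in>Tv G x. sl G f \<eta>)"

definition divisor :: "('v,'e) mgraph \<Rightarrow> (('v,'e) pt \<Rightarrow> int) \<Rightarrow> bool" where
  "divisor G D \<longleftrightarrow> finite {x. D x \<noteq> 0} \<and> {x. D x \<noteq> 0} \<subseteq> pts G"

definition effective :: "('v,'e) mgraph \<Rightarrow> (('v,'e) pt \<Rightarrow> int) \<Rightarrow> bool" where
  "effective G D \<longleftrightarrow> divisor G D \<and> (\<forall>x. D x \<ge> 0)"

definition deg :: "(('v,'e) pt \<Rightarrow> int) \<Rightarrow> int" where
  "deg D = (\<Sum>x\<in>{x. D x \<noteq> 0}. D x)"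

definition bnrp :: "('v,'e) mgraph \<Rightarrow> (('v,'e) pt \<Rightarrow> int) \<Rightarrow> (('v,'e) pt \<Rightarrow> int) \<Rightarrow> (('v,'e) pt \<Rightarrow> real) \<Rightarrow> bool" where
  "bnrp G D E f \<longleftrightarrow> (\<forall>x\<in>pts G. real_of_int (D x) + divf G f x \<ge> real_of_int (E x))"

definition RD :: "('v,'e) mgraph \<Rightarrow> (('v,'e) pt \<Rightarrow> int) \<Rightarrow> (('v,'e) pt \<Rightarrow> real) set" where
  "RD G D = {f \<in> PL G. \<forall>x\<in>pts G. real_of_int (D x) + divf G f x \<ge> 0}"

definition tcomb :: "('v,'e) mgraph \<Rightarrow> (('v,'e) pt \<Rightarrow> real) set \<Rightarrow> ((('v,'e) pt \<Rightarrow> real) \<Rightarrow> real) \<Rightarrow> ('v,'e) pt \<Rightarrow> real" where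
  "tcomb G F a = (\<lambda>x. if x \<in> pts G then Min ((\<lambda>f. f x + a f) ` F) else 0)"

definition tsubmodule :: "('v,'e) mgraph \<Rightarrow> (('v,'e) pt \<Rightarrow> real) set \<Rightarrow> bool" where
  "tsubmodule G \<Sigma> \<longleftrightarrow> (\<forall>F a. F \<subseteq> \<Sigma> \<and> finite F \<and> F \<noteq> {} \<longrightarrow> tcomb G F a \<in> \<Sigma>)"

definition fin_gen :: "('v,'e) mgraph \<Rightarrow> (('v,'e) pt \<Rightarrow> real) set \<Rightarrow> bool" where
  "fin_gen G \<Sigma> \<longleftrightarrow> (\<exists>F. finite F \<and> F \<subseteq> \<Sigma> \<and>
      \<Sigma> = {tcomb G H a | H a. H \<subseteq> F \<and> H \<noteq> {}})"

definition trop_dep :: "('v,'e) mgraph \<Rightarrow> nat \<Rightarrow> (nat \<Rightarrow> ('v,'e) pt \<Rightarrow> real) \<Rightarrow> bool" where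
  "trop_dep G n f \<longleftrightarrow> (\<exists>a::nat \<Rightarrow> real. \<forall>x\<in>pts G. \<exists>i<n. \<exists>j<n. i \<noteq> j \<and>
      f i x + a i = f j x + a j \<and> (\<forall>k<n. f i x + a i \<le> f k x + a k))"

definition all_dep :: "('v,'e) mgraph \<Rightarrow> nat \<Rightarrow> (('v,'e) pt \<Rightarrow> real) set \<Rightarrow> bool" where
  "all_dep G r \<Sigma> \<longleftrightarrow> (\<forall>f. (\<forall>i<r+2. f i \<in> \<Sigma>) \<longrightarrow> trop_dep G (r+2) f)"

definition trop_lin_series :: "('v,'e) mgraph \<Rightarrow> nat \<Rightarrow> (('v,'e) pt \<Rightarrow> int) \<Rightarrow> (('v,'e) pt \<Rightarrow> real) set \<Rightarrow> bool" where
  "trop_lin_series G r D \<Sigma> \<longleftrightarrow> divisor G D \<and> fin_gen G \<Sigma> \<and> tsubmodule G \<Sigma> \<and> \<Sigma> \<subseteq> RD G D \<and>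
     (\<forall>E. effective G E \<and> deg E = int r \<longrightarrow> (\<exists>f\<in>\<Sigma>. bnrp G D E f)) \<and>
     all_dep G r \<Sigma>"

definition cube :: "nat \<Rightarrow> nat \<Rightarrow> (nat \<Rightarrow> nat) set" where
  "cube r d = {x. (\<forall>i<d. x i \<le> r) \<and> (\<forall>i\<ge>d. x i = 0)}"

definition above :: "nat \<Rightarrow> (nat \<Rightarrow> nat) set \<Rightarrow> (nat \<Rightarrow> nat) \<Rightarrow> (nat \<Rightarrow> nat) set" where
  "above d P x = {y \<in> P. \<forall>i<d. x i \<le> y i}"

definition rankable :: "nat \<Rightarrow> (nat \<Rightarrow> nat) set \<Rightarrow> int \<Rightarrow> bool" where
  "rankable d P s \<longleftrightarrow> (\<forall>i<d. int (card ((\<lambda>y. y i) ` P)) = s + 1)"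

definition prank :: "nat \<Rightarrow> (nat \<Rightarrow> nat) set \<Rightarrow> int" where
  "prank d P = (THE s. rankable d P s)"

definition totally_rankable :: "nat \<Rightarrow> nat \<Rightarrow> (nat \<Rightarrow> nat) set \<Rightarrow> bool" where
  "totally_rankable r d P \<longleftrightarrow> P \<subseteq> cube r d \<and> (\<forall>x\<in>cube r d. \<exists>s. rankable d (above d P x) s)"

definition rank_array :: "nat \<Rightarrow> (nat \<Rightarrow> nat) set \<Rightarrow> (nat \<Rightarrow> nat) \<Rightarrow> int" where
  "rank_array d P x = prank d (above d P x)"

definition meet :: "nat \<Rightarrow> (nat \<Rightarrow> nat) set \<Rightarrow> nat \<Rightarrow> nat" where
  "meet d H = (\<lambda>i. if i < d then Min ((\<lambda>h. h i) ` H) else 0)"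

definition redundant :: "nat \<Rightarrow> (nat \<Rightarrow> nat) set \<Rightarrow> (nat \<Rightarrow> nat) \<Rightarrow> bool" where
  "redundant d P z \<longleftrightarrow> (\<exists>H \<subseteq> P. card H \<ge> 2 \<and> z = meet d H \<and> (\<forall>h\<in>H. \<exists>i<d. h i = z i))"

definition perm_array :: "nat \<Rightarrow> nat \<Rightarrow> (nat \<Rightarrow> nat) set \<Rightarrow> bool" where
  "perm_array r d P \<longleftrightarrow> totally_rankable r d P \<and> rankable d P (int r) \<and> (\<forall>z\<in>P. \<not> redundant d P z)"

definition pclosure :: "nat \<Rightarrow> (nat \<Rightarrow> nat) set \<Rightarrow> (nat \<Rightarrow> nat) set" where
  "pclosure d P = P \<union> {z. redundant d P z}"

definition standard_pa :: "nat \<Rightarrow> nat \<Rightarrow> (nat \<Rightarrow> nat) set" where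
  "standard_pa r d = {x \<in> cube r d. (\<Sum>i<d. x i) = r}"

text \<open>A slope structure is given by (V, S, ord, P): S \<eta> i = s^\<eta>_i for i \<le> r,
  ord x enumerates T_x(\<Gamma>) as ord x 0, ..., ord x (val x - 1), and P x is the permutation array at x.\<close>
definition slope_structure :: "('v,'e) mgraph \<Rightarrow> nat \<Rightarrow> ('v,'e) pt set \<Rightarrow> ('e tangent \<Rightarrow> nat \<Rightarrow> int)
   \<Rightarrow> (('v,'e) pt \<Rightarrow> nat \<Rightarrow> 'e tangent) \<Rightarrow> (('v,'e) pt \<Rightarrow> (nat \<Rightarrow> nat) set) \<Rightarrow> bool" where
  "slope_structure G r V S ord P \<longleftrightarrow>
     finite V \<and> V \<subseteq> pts G \<and> (\<forall>x\<in>pts G. val G x \<noteq> 2 \<longrightarrow> x \<in> V) \<and>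
     (\<forall>\<eta>\<in>tangents G. \<forall>i j. i < j \<and> j \<le> r \<longrightarrow> S \<eta> i < S \<eta> j) \<and>
     (\<forall>x\<in>pts G. bij_betw (ord x) {..<val G x} (Tv G x)) \<and>
     (\<forall>x\<in>pts G. perm_array r (val G x) (P x)) \<and>
     (\<forall>x\<in>pts G - V. P x = standard_pa r (val G x)) \<and>
     \<comment> \<open>opposite directions in a component of \<Gamma> - V\<close>
     (\<forall>x\<in>pts G - V. \<forall>\<eta>\<in>Tv G x. \<forall>\<xi>\<in>Tv G x. \<eta> \<noteq> \<xi> \<longrightarrow> (\<forall>i\<le>r. S \<eta> i + S \<xi> (r - i) = 0)) \<and>
     \<comment> \<open>constancy in each direction along segments contained in a component of \<Gamma> - V\<close>
     (\<forall>e\<in>edges G. \<forall>s t. 0 \<le> s \<and> s \<le> t \<and> t \<le> elen G e \<and> (\<forall>u\<in>{s..t}. epar G e u \<notin> V) \<longrightarrow>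
        (\<forall>u\<in>{s..t}. \<forall>u'\<in>{s..t}. \<forall>i\<le>r.
           (u < elen G e \<and> u' < elen G e \<longrightarrow> S (e,u,True) i = S (e,u',True) i) \<and>
           (0 < u \<and> 0 < u' \<longrightarrow> S (e,u,False) i = S (e,u',False) i)))"

definition idxvec :: "('v,'e) mgraph \<Rightarrow> nat \<Rightarrow> ('e tangent \<Rightarrow> nat \<Rightarrow> int)
   \<Rightarrow> (('v,'e) pt \<Rightarrow> nat \<Rightarrow> 'e tangent) \<Rightarrow> ('v,'e) pt \<Rightarrow> (('v,'e) pt \<Rightarrow> real) \<Rightarrow> nat \<Rightarrow> nat" where
  "idxvec G r S ord x f = (\<lambda>k. if k < val G x then
      (THE i. i \<le> r \<and> sl G f (ord x k) = real_of_int (S (ord x k) i)) else 0)"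

definition compatible :: "('v,'e) mgraph \<Rightarrow> nat \<Rightarrow> ('e tangent \<Rightarrow> nat \<Rightarrow> int)
   \<Rightarrow> (('v,'e) pt \<Rightarrow> nat \<Rightarrow> 'e tangent) \<Rightarrow> (('v,'e) pt \<Rightarrow> (nat \<Rightarrow> nat) set) \<Rightarrow> (('v,'e) pt \<Rightarrow> real) \<Rightarrow> bool" where
  "compatible G r S ord P f \<longleftrightarrow>
     (\<forall>\<eta>\<in>tangents G. \<exists>i\<le>r. sl G f \<eta> = real_of_int (S \<eta> i)) \<and>
     (\<forall>x\<in>pts G. idxvec G r S ord x f \<in> pclosure (val G x) (P x))"

definition RS :: "('v,'e) mgraph \<Rightarrow> nat \<Rightarrow> ('e tangent \<Rightarrow> nat \<Rightarrow> int)
   \<Rightarrow> (('v,'e) pt \<Rightarrow> nat \<Rightarrow> 'e tangent) \<Rightarrow> (('v,'e) pt \<Rightarrow> (nat \<Rightarrow> nat) set) \<Rightarrow> (('v,'e) pt \<Rightarrow> real) set" where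
  "RS G r S ord P = {f \<in> PL G. compatible G r S ord P f}"

definition rho_v :: "('v,'e) mgraph \<Rightarrow> nat \<Rightarrow> ('e tangent \<Rightarrow> nat \<Rightarrow> int)
   \<Rightarrow> (('v,'e) pt \<Rightarrow> nat \<Rightarrow> 'e tangent) \<Rightarrow> (('v,'e) pt \<Rightarrow> (nat \<Rightarrow> nat) set) \<Rightarrow> ('v,'e) pt \<Rightarrow> (('v,'e) pt \<Rightarrow> real) \<Rightarrow> int" where
  "rho_v G r S ord P x f = rank_array (val G x) (P x) (idxvec G r S ord x f)"

definition lrp :: "('v,'e) mgraph \<Rightarrow> nat \<Rightarrow> ('e tangent \<Rightarrow> nat \<Rightarrow> int)
   \<Rightarrow> (('v,'e) pt \<Rightarrow> nat \<Rightarrow> 'e tangent) \<Rightarrow> (('v,'e) pt \<Rightarrow> (nat \<Rightarrow> nat) set) \<Rightarrow> (('v,'e) pt \<Rightarrow> int) \<Rightarrow> (('v,'e) pt \<Rightarrow> real) \<Rightarrow> bool" where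
  "lrp G r S ord P E f \<longleftrightarrow> (\<forall>x\<in>pts G. rho_v G r S ord P x f \<ge> E x)"

definition sup_closed :: "('v,'e) mgraph \<Rightarrow> (('v,'e) pt \<Rightarrow> real) set \<Rightarrow> bool" where
  "sup_closed G \<Sigma> \<longleftrightarrow> (\<forall>f\<in>PL G. (\<forall>\<epsilon>>0. \<exists>g\<in>\<Sigma>. \<forall>x\<in>pts G. \<bar>g x - f x\<bar> < \<epsilon>) \<longrightarrow> f \<in> \<Sigma>)"

definition structured :: "('v,'e) mgraph \<Rightarrow> nat \<Rightarrow> (('v,'e) pt \<Rightarrow> real) set \<Rightarrow> bool" where
  "structured G r \<Sigma> \<longleftrightarrow> (\<exists>V S ord P. slope_structure G r V S ord P \<and> \<Sigma> \<subseteq> RS G r S ord P)"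

definition admissible :: "('v,'e) mgraph \<Rightarrow> nat \<Rightarrow> (('v,'e) pt \<Rightarrow> int) \<Rightarrow> (('v,'e) pt \<Rightarrow> real) set \<Rightarrow> bool" where
  "admissible G r D \<Sigma> \<longleftrightarrow> tsubmodule G \<Sigma> \<and> \<Sigma> \<subseteq> RD G D \<and> sup_closed G \<Sigma> \<and>
     (\<exists>V S ord P. slope_structure G r V S ord P \<and> \<Sigma> \<subseteq> RD G D \<inter> RS G r S ord P \<and>
        (\<forall>E. effective G E \<and> deg E = int r \<longrightarrow>
           (\<exists>f\<in>\<Sigma>. bnrp G D E f \<and> lrp G r S ord P E f)))"

definition comb_limit_lin_series :: "('v,'e) mgraph \<Rightarrow> nat \<Rightarrow> (('v,'e) pt \<Rightarrow> int) \<Rightarrow> (('v,'e) pt \<Rightarrow> real) set \<Rightarrow> bool" where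
  "comb_limit_lin_series G r D \<Sigma> \<longleftrightarrow> divisor G D \<and> fin_gen G \<Sigma> \<and> admissible G r D \<Sigma> \<and> all_dep G r \<Sigma>"

end

theory Submission
  imports Defs "HOL-Library.Infinite_Set"
begin

text \<open>The given slope structure itself witnesses admissibility.  For an effective \<open>E\<close>, replace each
  \<open>x\<close> in its support by \<open>E x\<close> distinct points on a ray from \<open>x\<close> and let these tend to \<open>x\<close>.  A limit \<open>f\<close>
  of functions of \<open>\<Sigma>\<close> satisfying (BNRP) for the moved divisors still satisfies it for \<open>E\<close>.  Each moved
  point forces a drop of slope along the ray, and by finite generation the \<open>E x + 1\<close> slopes that occur
  belong to generators which, suitably translated, touch \<open>f\<close> from above at \<open>x\<close>; their index vectors
  lie above that of \<open>f\<close>, so the rank at \<open>x\<close> is at least \<open>E x\<close>.\<close>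

text \<open>(BNRP) for \<open>E\<close> alone only bounds the sum of the outgoing slopes at a point,
  which does not say how many points of the permutation array lie above an index vector. At a moved
  point, chosen inside an edge and off the support of \<open>D\<close>, there are just two opposite
  directions, and \<open>divf\<close> at least 1 means that the slope falls strictly. Since slopes
  are integers, \<open>k\<close> falls yield a total drop of at least \<open>k\<close>, which
  returns as (BNRP) at \<open>x\<close>, and also \<open>k + 1\<close> distinct slopes; a rank is
  one less than the number of values of a coordinate, so this is rank at least \<open>k\<close>. One
  direction per point suffices because total rankability makes every coordinate give the same count.

  The limit is taken of the coefficients of tropical combinations rather than of the functions
  alone: slopes are not continuous in the sup norm, but the set of generators attaining the minimum
  is semicontinuous. The same compactness of coefficients gives sup-norm closedness.\<close>

section \<open>Rays, germs of PL functions and outgoing slopes\<close>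

definition ray :: "('v,'e) mgraph \<Rightarrow> 'e tangent \<Rightarrow> real \<Rightarrow> ('v,'e) pt" where
  "ray G \<eta> h = epar G (fst \<eta>) (if snd (snd \<eta>) then fst (snd \<eta>) + h else fst (snd \<eta>) - h)"

lemma sl_ray: "sl G f \<eta> = Lim (at_right 0) (\<lambda>h. (f (ray G \<eta> h) - f (ray G \<eta> 0)) / h)"
  by (cases \<eta>) (auto simp: sl_def ray_def)

lemma sl_eqI:
  assumes "\<delta> > 0" and "\<And>h. 0 \<le> h \<Longrightarrow> h \<le> \<delta> \<Longrightarrow> f (ray G \<eta> h) = f (ray G \<eta> 0) + m * h"
  shows "sl G f \<eta> = m"
proof -
  have "(f (ray G \<eta> h) - f (ray G \<eta> 0)) / h = m" if "0 < h" "h < \<delta>" for h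
    using assms(2)[of h] that by (simp add: field_simps)
  then have "eventually (\<lambda>h. (f (ray G \<eta> h) - f (ray G \<eta> 0)) / h = m) (at_right 0)"
    unfolding eventually_at_right_field using assms(1) by blast
  then have "((\<lambda>h. (f (ray G \<eta> h) - f (ray G \<eta> 0)) / h) \<longlongrightarrow> m) (at_right 0)"
    by (rule tendsto_eventually)
  then show ?thesis unfolding sl_ray by (intro tendsto_Lim) auto
qed

lemma ray_zero_Tv: "\<eta> \<in> Tv G x \<Longrightarrow> ray G \<eta> 0 = x"
  by (auto simp: Tv_def ray_def)

text \<open>The half-open interval is what a forward tangent needs: at a break point it must read
  the piece ahead of it. \<open>piece_left\<close> is the mirror image for backward
  tangents.\<close>

lemma piece_right:
  fixes a :: "nat \<Rightarrow> real"
  shows "a 0 \<le> t \<Longrightarrow> t < a k \<Longrightarrow> \<exists>i<k. a i \<le> t \<and> t < a (Suc i)"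
proof (induction k)
  case (Suc k)
  then show ?case by (cases "t < a k") (auto simp: less_Suc_eq)
qed simp

lemma piece_left:
  fixes a :: "nat \<Rightarrow> real"
  shows "a 0 < t \<Longrightarrow> t \<le> a k \<Longrightarrow> \<exists>i<k. a i < t \<and> t \<le> a (Suc i)"
proof (induction k)
  case (Suc k)
  then show ?case by (cases "t \<le> a k") (auto simp: less_Suc_eq)
qed simp

text \<open>\<open>sl\<close> is a \<open>Lim\<close>, which carries no information until the limit
  is known to exist. Being affine near the base provides this, and integrality is inherited from the
  slopes \<open>m\<close> in the definition of \<open>PL\<close>.\<close>

lemma PL_linear_on_ray:
  assumes "f \<in> PL G" and "\<eta> \<in> tangents G"
  shows "\<exists>\<delta>>0. \<forall>h. 0 \<le> h \<and> h \<le> \<delta> \<longrightarrow> f (ray G \<eta> h) = f (ray G \<eta> 0) + sl G f \<eta> * h"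
    and "sl G f \<eta> \<in> \<int>"
proof -
  obtain e t b where \<eta>: "\<eta> = (e, t, b)" by (cases \<eta>)
  have e: "e \<in> edges G" using assms(2) by (auto simp: \<eta> tangents_def)
  then obtain a k m where a: "a 0 = 0" "a k = elen G e"
    and lin: "\<forall>i<k. \<forall>s\<in>{a i..a (Suc i)}. f (epar G e s) = f (epar G e (a i)) + of_int (m i) * (s - a i)"
    using assms(1) unfolding PL_def by blast
  have "\<exists>\<delta>>0. \<exists>n::int. \<forall>h. 0 \<le> h \<and> h \<le> \<delta> \<longrightarrow> f (ray G \<eta> h) = f (ray G \<eta> 0) + n * h"
  proof (cases b)
    case True
    then obtain i where i: "i < k" "a i \<le> t" "t < a (Suc i)"
      using piece_right[of a t k] assms(2) a by (auto simp: \<eta> tangents_def)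
    show ?thesis
    proof (intro exI conjI allI impI)
      show "a (Suc i) - t > 0" using i by simp
      fix h assume "0 \<le> h \<and> h \<le> a (Suc i) - t"
      then have "f (epar G e s) = f (epar G e (a i)) + of_int (m i) * (s - a i)" if "s \<in> {t, t + h}" for s
        using lin[rule_format, of i s] i that by auto
      from this[of t] this[of "t + h"] show "f (ray G \<eta> h) = f (ray G \<eta> 0) + of_int (m i) * h"
        using True by (simp add: \<eta> ray_def algebra_simps)
    qed
  next
    case False
    then obtain i where i: "i < k" "a i < t" "t \<le> a (Suc i)"
      using piece_left[of a t k] assms(2) a by (auto simp: \<eta> tangents_def)
    show ?thesis
    proof (intro exI conjI allI impI)
      show "t - a i > 0" using i by simp
      fix h assume "0 \<le> h \<and> h \<le> t - a i"
      then have "f (epar G e s) = f (epar G e (a i)) + of_int (m i) * (s - a i)" if "s \<in> {t, t - h}" for s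
        using lin[rule_format, of i s] i that by auto
      from this[of t] this[of "t - h"] show "f (ray G \<eta> h) = f (ray G \<eta> 0) + of_int (- m i) * h"
        using False by (simp add: \<eta> ray_def algebra_simps)
    qed
  qed
  then obtain \<delta> and n :: int where \<delta>: "\<delta> > 0"
    and n: "\<And>h. 0 \<le> h \<Longrightarrow> h \<le> \<delta> \<Longrightarrow> f (ray G \<eta> h) = f (ray G \<eta> 0) + of_int n * h" by blast
  then have "sl G f \<eta> = n" by (intro sl_eqI[of \<delta>])
  then show "\<exists>\<delta>>0. \<forall>h. 0 \<le> h \<and> h \<le> \<delta> \<longrightarrow> f (ray G \<eta> h) = f (ray G \<eta> 0) + sl G f \<eta> * h"
    using \<delta> n by metis
  show "sl G f \<eta> \<in> \<int>" using \<open>sl G f \<eta> = n\<close> by simp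
qed

lemma finite_PL_linear_on_ray:
  assumes "finite F" and "F \<subseteq> PL G" and "\<eta> \<in> tangents G"
  shows "\<exists>\<delta>>0. \<forall>f\<in>F. \<forall>h. 0 \<le> h \<and> h \<le> \<delta> \<longrightarrow> f (ray G \<eta> h) = f (ray G \<eta> 0) + sl G f \<eta> * h"
  using assms(1,2)
proof (induction F)
  case empty
  show ?case by (intro exI[of _ 1]) simp
next
  case (insert g F)
  then obtain \<delta> where "\<delta> > 0"
    "\<forall>f\<in>F. \<forall>h. 0 \<le> h \<and> h \<le> \<delta> \<longrightarrow> f (ray G \<eta> h) = f (ray G \<eta> 0) + sl G f \<eta> * h" by blast
  moreover obtain \<delta>' where "\<delta>' > 0"
    "\<forall>h. 0 \<le> h \<and> h \<le> \<delta>' \<longrightarrow> g (ray G \<eta> h) = g (ray G \<eta> 0) + sl G g \<eta> * h"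
    using PL_linear_on_ray(1)[of g G \<eta>] insert.prems assms(3) by blast
  ultimately show ?case
    by (intro exI[of _ "min \<delta> \<delta>'"]) (metis insert_iff min_less_iff_conj min.boundedE)
qed

definition rpar :: "'e tangent \<Rightarrow> real \<Rightarrow> real" where
  "rpar \<eta> h = (if snd (snd \<eta>) then fst (snd \<eta>) + h else fst (snd \<eta>) - h)"

lemma ray_interior:
  assumes "\<eta> \<in> tangents G"
  shows "\<exists>\<delta>>0. \<forall>h. 0 < h \<and> h \<le> \<delta> \<longrightarrow> ray G \<eta> h = In (fst \<eta>) (rpar \<eta> h) \<and>
    0 < rpar \<eta> h \<and> rpar \<eta> h < elen G (fst \<eta>)"
proof -
  obtain e t b where \<eta>: "\<eta> = (e, t, b)" by (cases \<eta>)
  \<comment> \<open>Half of what remains of the edge, so that even \<open>h = \<delta>\<close> stays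
    strictly inside it.\<close>
  define \<delta> where "\<delta> = (if b then elen G e - t else t) / 2"
  have "\<delta> > 0" using assms by (auto simp: \<eta> \<delta>_def tangents_def)
  moreover have "ray G \<eta> h = In (fst \<eta>) (rpar \<eta> h) \<and> 0 < rpar \<eta> h \<and> rpar \<eta> h < elen G (fst \<eta>)"
    if "0 < h" "h \<le> \<delta>" for h
  proof -
    have "0 < rpar \<eta> h \<and> rpar \<eta> h < elen G e"
      using assms that by (auto simp: \<eta> \<delta>_def tangents_def rpar_def field_simps split: if_splits)
    then show ?thesis by (simp add: \<eta> ray_def rpar_def epar_def split: if_splits)
  qed
  ultimately show ?thesis by blast
qed

lemma In_ray_pts:
  assumes "\<eta> \<in> tangents G" "0 < rpar \<eta> h" "rpar \<eta> h < elen G (fst \<eta>)"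
  shows "In (fst \<eta>) (rpar \<eta> h) \<in> pts G"
  using assms by (cases \<eta>) (auto simp: pts_def tangents_def)

text \<open>The free \<open>b\<close> lets the two tangents at a point of a ray be named as onward
  and backward, whatever the orientation of the ray.\<close>

lemma Tv_In:
  assumes "e \<in> edges G" "0 < t" "t < elen G e"
  shows "Tv G (In e t) = {(e, t, b), (e, t, \<not> b)}"
  using assms by (cases b) (auto simp: Tv_def tangents_def epar_def split: if_splits)

text \<open>A ray is injective inside its edge, so only finitely many parameters hit
  \<open>X\<close>. This later keeps the moved points off the support of \<open>D\<close>.\<close>

lemma ray_avoids_finite:
  assumes "\<eta> \<in> tangents G" and "finite X"
  shows "\<exists>\<delta>>0. \<forall>h. 0 < h \<and> h \<le> \<delta> \<longrightarrow> ray G \<eta> h \<notin> X"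
proof -
  obtain \<delta>0 where \<delta>0: "\<delta>0 > 0"
    "\<And>h. 0 < h \<Longrightarrow> h \<le> \<delta>0 \<Longrightarrow> ray G \<eta> h = In (fst \<eta>) (rpar \<eta> h)"
    using ray_interior[OF assms(1)] by blast
  define Z where "Z = {h. 0 < h \<and> h \<le> \<delta>0 \<and> ray G \<eta> h \<in> X}"
  have "inj_on (ray G \<eta>) Z"
    unfolding inj_on_def Z_def by (auto simp: \<delta>0(2) rpar_def split: if_splits)
  moreover have "ray G \<eta> ` Z \<subseteq> X" by (auto simp: Z_def)
  ultimately have "finite Z" using assms(2) by (metis finite_imageD finite_subset)
  \<comment> \<open>Halving the least bad parameter makes \<open>h \<le> \<delta>\<close> safe;
    inserting \<open>\<delta>0\<close> covers the case of no bad parameter.\<close>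
  define \<delta> where "\<delta> = Min (insert \<delta>0 Z) / 2"
  have pos: "Min (insert \<delta>0 Z) > 0" using \<open>finite Z\<close> \<delta>0(1) by (auto simp: Z_def)
  have "ray G \<eta> h \<notin> X" if h: "0 < h" "h \<le> \<delta>" for h
  proof
    assume "ray G \<eta> h \<in> X"
    moreover have "h < Min (insert \<delta>0 Z)" using h pos by (simp add: \<delta>_def)
    moreover have "Min (insert \<delta>0 Z) \<le> \<delta>0" using \<open>finite Z\<close> by simp
    ultimately have "h \<in> Z" using h by (simp add: Z_def)
    then have "Min (insert \<delta>0 Z) \<le> h" using \<open>finite Z\<close> by simp
    then show False using \<open>h < _\<close> by simp
  qed
  then show ?thesis using pos by (intro exI[of _ \<delta>]) (simp add: \<delta>_def)
qed

lemma sl_inside_ray: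
  assumes lin: "\<And>h. 0 \<le> h \<Longrightarrow> h \<le> \<delta> \<Longrightarrow> f (ray G \<eta> h) = f (ray G \<eta> 0) + m * h"
    and h: "0 < h" "h < \<delta>"
  shows "sl G f (fst \<eta>, rpar \<eta> h, snd (snd \<eta>)) = m"
    and "sl G f (fst \<eta>, rpar \<eta> h, \<not> snd (snd \<eta>)) = - m"
proof -
  have ray: "ray G (fst \<eta>, rpar \<eta> h, snd (snd \<eta>)) h' = ray G \<eta> (h + h')" for h'
    by (simp add: ray_def rpar_def algebra_simps)
  show "sl G f (fst \<eta>, rpar \<eta> h, snd (snd \<eta>)) = m"
  proof (rule sl_eqI[of "\<delta> - h"])
    fix h' assume "0 \<le> h'" "h' \<le> \<delta> - h"
    then show "f (ray G (fst \<eta>, rpar \<eta> h, snd (snd \<eta>)) h') =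
        f (ray G (fst \<eta>, rpar \<eta> h, snd (snd \<eta>)) 0) + m * h'"
      using lin[of h] lin[of "h + h'"] h unfolding ray by (simp add: algebra_simps)
  qed (use h in simp)
  have ray': "ray G (fst \<eta>, rpar \<eta> h, \<not> snd (snd \<eta>)) h' = ray G \<eta> (h - h')" for h'
    by (simp add: ray_def rpar_def algebra_simps)
  show "sl G f (fst \<eta>, rpar \<eta> h, \<not> snd (snd \<eta>)) = - m"
  proof (rule sl_eqI[of h])
    fix h' assume "0 \<le> h'" "h' \<le> h"
    then show "f (ray G (fst \<eta>, rpar \<eta> h, \<not> snd (snd \<eta>)) h') =
        f (ray G (fst \<eta>, rpar \<eta> h, \<not> snd (snd \<eta>)) 0) + - m * h'"
      using lin[of h] lin[of "h - h'"] h unfolding ray' by (simp add: algebra_simps)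
  qed (use h in simp)
qed

section \<open>Tropical combinations and their active generators\<close>

lemma tcomb_le:
  assumes "finite H" "g \<in> H" "x \<in> pts G"
  shows "tcomb G H a x \<le> g x + a g"
  using assms by (simp add: tcomb_def)

lemma tcomb_attained:
  assumes "finite H" "H \<noteq> {}" "x \<in> pts G"
  obtains g where "g \<in> H" "tcomb G H a x = g x + a g"
proof -
  have "Min ((\<lambda>f. f x + a f) ` H) \<in> (\<lambda>f. f x + a f) ` H" using assms by (intro Min_in) auto
  then show ?thesis using that assms(3) by (auto simp: tcomb_def)
qed

text \<open>The generators whose translates touch the combination from above at \<open>x\<close>.
  Formulated by comparison within \<open>H\<close>, so a common shift of the coefficients visibly
  changes nothing.\<close>

definition active :: "(('v,'e) pt \<Rightarrow> real) set \<Rightarrow> ((('v,'e) pt \<Rightarrow> real) \<Rightarrow> real) \<Rightarrow> ('v,'e) pt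
    \<Rightarrow> (('v,'e) pt \<Rightarrow> real) set" where
  "active H a x = {g \<in> H. \<forall>g'\<in>H. g x + a g \<le> g' x + a g'}"

lemma active_iff:
  assumes "finite H" "x \<in> pts G"
  shows "g \<in> active H a x \<longleftrightarrow> g \<in> H \<and> tcomb G H a x = g x + a g"
proof
  assume g: "g \<in> active H a x"
  then have "H \<noteq> {}" by (auto simp: active_def)
  then obtain g' where "g' \<in> H" "tcomb G H a x = g' x + a g'" using tcomb_attained assms by metis
  then show "g \<in> H \<and> tcomb G H a x = g x + a g"
    using g tcomb_le[OF assms(1) _ assms(2), of g a] by (force simp: active_def)
qed (use tcomb_le[OF assms(1) _ assms(2), of _ a] in \<open>auto simp: active_def\<close>)

lemma tangent_base_pts: "wf_mgraph G \<Longrightarrow> \<eta> \<in> tangents G \<Longrightarrow> ray G \<eta> 0 \<in> pts G"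
  by (cases \<eta>) (auto simp: wf_mgraph_def tangents_def ray_def epar_def pts_def split: if_splits)

text \<open>The slope of a tropical combination is the least slope among the generators active at
  the point: each such translate lies above and touches at \<open>x\<close>, and near
  \<open>x\<close> one of them coincides with the combination.\<close>

lemma sl_tcomb:
  assumes G: "wf_mgraph G" and H: "finite H" "H \<noteq> {}" "H \<subseteq> PL G" and f: "tcomb G H a \<in> PL G"
    and \<eta>: "\<eta> \<in> Tv G x"
  shows "g \<in> active H a x \<Longrightarrow> sl G (tcomb G H a) \<eta> \<le> sl G g \<eta>"
    and "\<exists>g\<in>active H a x. sl G (tcomb G H a) \<eta> = sl G g \<eta>"
proof -
  let ?f = "tcomb G H a"
  have \<eta>t: "\<eta> \<in> tangents G" and x: "ray G \<eta> 0 = x" "x \<in> pts G"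
    using \<eta> tangent_base_pts[OF G, of \<eta>] ray_zero_Tv[OF \<eta>] by (auto simp: Tv_def)
  obtain \<delta>1 where "\<delta>1 > 0" and lin1:
    "\<And>f h. f \<in> insert ?f H \<Longrightarrow> 0 \<le> h \<Longrightarrow> h \<le> \<delta>1 \<Longrightarrow> f (ray G \<eta> h) = f x + sl G f \<eta> * h"
    using finite_PL_linear_on_ray[of "insert ?f H" G \<eta>] H f \<eta>t unfolding x
    by (metis finite.insertI insert_subset)
  obtain \<delta>2 where "\<delta>2 > 0" and int:
    "\<And>h. 0 < h \<Longrightarrow> h \<le> \<delta>2 \<Longrightarrow> ray G \<eta> h \<in> pts G"
    using ray_interior[OF \<eta>t] In_ray_pts[OF \<eta>t] by metis
  define \<delta> where "\<delta> = min \<delta>1 \<delta>2"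
  have \<delta>: "\<delta> > 0" "\<delta> \<le> \<delta>1" "\<delta> \<le> \<delta>2" using \<open>\<delta>1 > 0\<close> \<open>\<delta>2 > 0\<close> by (auto simp: \<delta>_def)
  {
    assume "g \<in> active H a x"
    then have g: "g \<in> H" "?f x = g x + a g" using active_iff[OF H(1) x(2)] by auto
    have "?f (ray G \<eta> \<delta>) \<le> g (ray G \<eta> \<delta>) + a g" using tcomb_le[OF H(1) g(1) int] \<delta> by auto
    then show "sl G ?f \<eta> \<le> sl G g \<eta>" using lin1[of ?f \<delta>] lin1[of g \<delta>] g \<delta> by simp
  }
  have "\<exists>g\<in>H. ?f (ray G \<eta> h) = g (ray G \<eta> h) + a g" if "h \<in> {0<..\<delta>}" for h
  proof -
    have "ray G \<eta> h \<in> pts G" using that \<delta> by (intro int) auto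
    then show ?thesis using tcomb_attained[OF H(1,2)] by metis
  qed
  then have "\<forall>h\<in>{0<..\<delta>}. \<exists>g\<in>H. ?f (ray G \<eta> h) = g (ray G \<eta> h) + a g" by blast
  moreover have "infinite {0<..\<delta>}" using \<delta>(1) by (simp add: infinite_Ioc)
  \<comment> \<open>With finitely many generators, one agrees with the combination at two
    parameters. Both are affine there, so they agree in slope and, back at the base, in
    value.\<close>
  ultimately have "\<exists>g\<in>H. infinite {h \<in> {0<..\<delta>}. ?f (ray G \<eta> h) = g (ray G \<eta> h) + a g}"
    using H(1) by (intro pigeonhole_infinite_rel)
  then obtain g where g: "g \<in> H" and
    inf: "infinite {h \<in> {0<..\<delta>}. ?f (ray G \<eta> h) = g (ray G \<eta> h) + a g}" by (elim bexE)
  then obtain h h' where hh: "h \<noteq> h'" "h \<in> {0<..\<delta>}" "h' \<in> {0<..\<delta>}"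
    and eq: "?f (ray G \<eta> h) = g (ray G \<eta> h) + a g" "?f (ray G \<eta> h') = g (ray G \<eta> h') + a g"
  proof -
    obtain C where "card C = 2" "C \<subseteq> {h \<in> {0<..\<delta>}. ?f (ray G \<eta> h) = g (ray G \<eta> h) + a g}"
      using infinite_arbitrarily_large[OF inf, of 2] by blast
    then show ?thesis using that by (auto simp: card_2_iff)
  qed
  have 1: "?f x + sl G ?f \<eta> * h = g x + sl G g \<eta> * h + a g"
    and 2: "?f x + sl G ?f \<eta> * h' = g x + sl G g \<eta> * h' + a g"
    using eq hh lin1[of ?f h] lin1[of g h] lin1[of ?f h'] lin1[of g h'] g \<delta> by auto
  then have "(sl G ?f \<eta> - sl G g \<eta>) * (h - h') = 0" by (simp add: algebra_simps)
  then have s: "sl G ?f \<eta> = sl G g \<eta>" using hh by simp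
  with 1 have "g \<in> active H a x" using active_iff[OF H(1) x(2)] g by auto
  with s show "\<exists>g\<in>active H a x. sl G ?f \<eta> = sl G g \<eta>" by blast
qed

section \<open>Compactness of coefficients and sup-norm closedness\<close>

lemma PL_bounded:
  assumes G: "wf_mgraph G" and f: "f \<in> PL G"
  shows "\<exists>B. \<forall>x\<in>pts G. \<bar>f x\<bar> \<le> B"
proof -
  have "\<exists>B. \<forall>t. 0 < t \<and> t < elen G e \<longrightarrow> \<bar>f (In e t)\<bar> \<le> B" if e: "e \<in> edges G" for e
  proof -
    obtain a k m where a: "a 0 = 0" "a k = elen G e"
      and lin: "\<forall>i<k. \<forall>s\<in>{a i..a (Suc i)}. f (epar G e s) = f (epar G e (a i)) + of_int (m i) * (s - a i)"
      using f e unfolding PL_def by blast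
    let ?c = "\<lambda>i. \<bar>f (epar G e (a i))\<bar> + \<bar>of_int (m i)\<bar> * \<bar>a (Suc i) - a i\<bar>"
    have "\<bar>f (In e t)\<bar> \<le> (\<Sum>i<k. ?c i)" if t: "0 < t" "t < elen G e" for t
    proof -
      obtain i where i: "i < k" "a i \<le> t" "t < a (Suc i)" using piece_right[of a t k] a t by auto
      have "\<bar>f (In e t)\<bar> = \<bar>f (epar G e (a i)) + of_int (m i) * (t - a i)\<bar>"
        using lin[rule_format, of i t] i t by (simp add: epar_def[of G e t])
      also have "\<dots> \<le> \<bar>f (epar G e (a i))\<bar> + \<bar>of_int (m i)\<bar> * \<bar>t - a i\<bar>"
        by (metis abs_mult abs_triangle_ineq)
      also have "\<dots> \<le> ?c i" using i by (intro add_left_mono mult_left_mono) auto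
      also have "\<dots> \<le> (\<Sum>i<k. ?c i)" using i(1) by (intro member_le_sum) auto
      finally show ?thesis .
    qed
    then show ?thesis by blast
  qed
  then obtain B where B: "\<And>e t. e \<in> edges G \<Longrightarrow> 0 < t \<Longrightarrow> t < elen G e \<Longrightarrow> \<bar>f (In e t)\<bar> \<le> B e" by metis
  have fin: "finite (verts G)" "finite (edges G)" using G by (auto simp: wf_mgraph_def)
  show ?thesis
  proof (intro exI ballI)
    fix x assume "x \<in> pts G"
    then consider v where "v \<in> verts G" "x = Vt v"
      | e t where "e \<in> edges G" "0 < t" "t < elen G e" "x = In e t" by (auto simp: pts_def)
    then show "\<bar>f x\<bar> \<le> (\<Sum>v\<in>verts G. \<bar>f (Vt v)\<bar>) + (\<Sum>e\<in>edges G. \<bar>B e\<bar>)"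
    proof cases
      case 1
      then have "\<bar>f x\<bar> \<le> (\<Sum>v\<in>verts G. \<bar>f (Vt v)\<bar>)" using fin by (auto intro!: member_le_sum)
      moreover have "0 \<le> (\<Sum>e\<in>edges G. \<bar>B e\<bar>)" by (simp add: sum_nonneg)
      ultimately show ?thesis by linarith
    next
      case 2
      have "\<bar>f x\<bar> \<le> \<bar>B e\<bar>" using B[of e t] 2 by simp
      also have "\<dots> \<le> (\<Sum>e\<in>edges G. \<bar>B e\<bar>)" using fin 2 by (auto intro!: member_le_sum)
      moreover have "0 \<le> (\<Sum>v\<in>verts G. \<bar>f (Vt v)\<bar>)" by (simp add: sum_nonneg)
      ultimately show ?thesis by linarith
    qed
  qed
qed

lemma finite_convergent_subsequence:
  fixes b :: "nat \<Rightarrow> 'a \<Rightarrow> real"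
  assumes "finite H" and "\<And>g. g \<in> H \<Longrightarrow> Bseq (\<lambda>n. b n g)"
  shows "\<exists>s. strict_mono s \<and> (\<forall>g\<in>H. convergent (\<lambda>n. b (s n) g))"
  using assms
proof (induction H)
  case empty
  show ?case by (intro exI[of _ id]) (simp add: strict_mono_def)
next
  case (insert g H)
  then obtain s where s: "strict_mono s" "\<forall>g\<in>H. convergent (\<lambda>n. b (s n) g)" by auto
  obtain s' :: "nat \<Rightarrow> nat" where s': "strict_mono s'" "monoseq (\<lambda>n. b (s (s' n)) g)"
    using seq_monosub[of "\<lambda>n. b (s n) g"] by blast
  have "Bseq (\<lambda>n. b (s (s' n)) g)"
    using Bseq_subseq[of "\<lambda>n. b n g" "s \<circ> s'"] insert.prems(1)[of g] by (simp add: o_def)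
  then have "convergent (\<lambda>n. b (s (s' n)) g)" using s'(2) by (rule Bseq_monoseq_convergent)
  moreover have "convergent (\<lambda>n. b (s (s' n)) g')" if "g' \<in> H" for g'
    using convergent_subseq_convergent[OF s(2)[rule_format, OF that] s'(1)] by (simp add: o_def)
  ultimately show ?case using s(1) s'(1)
    by (intro exI[of _ "s \<circ> s'"]) (auto simp: strict_mono_def)
qed

lemma tcomb_drop_inactive:
  fixes G :: "('v,'e) mgraph" and a :: "(('v,'e) pt \<Rightarrow> real) \<Rightarrow> real"
  assumes "finite H" "H \<noteq> {}"
  defines "H' \<equiv> {g \<in> H. \<exists>x\<in>pts G. tcomb G H a x = g x + a g}"
  shows "tcomb G H' a = tcomb G H a"
proof
  fix x
  show "tcomb G H' a x = tcomb G H a x"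
  proof (cases "x \<in> pts G")
    case True
    have fin: "finite H'" using assms(1) by (simp add: H'_def)
    obtain g where g: "g \<in> H" "tcomb G H a x = g x + a g" using tcomb_attained[OF assms(1,2) True] by blast
    then have "g \<in> H'" using True by (auto simp: H'_def)
    have "tcomb G H' a x \<le> tcomb G H a x" using tcomb_le[OF fin \<open>g \<in> H'\<close> True, of a] g by simp
    moreover obtain g' where "g' \<in> H'" "tcomb G H' a x = g' x + a g'"
      using tcomb_attained[OF fin _ True] \<open>g \<in> H'\<close> by blast
    then have "tcomb G H a x \<le> tcomb G H' a x"
      using tcomb_le[OF assms(1) _ True, of g' a] by (simp add: H'_def)
    ultimately show ?thesis by simp
  qed (simp add: tcomb_def)
qed

text \<open>Once generators that never attain the minimum are dropped, the coefficients of a tropical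
  combination differ by at most twice a common bound of the generators; this makes a finitely
  generated submodule compact up to translation.\<close>

lemma tcomb_compactness:
  assumes "pts G \<noteq> {}" and F: "finite F" and B: "\<forall>g\<in>F. \<forall>x\<in>pts G. \<bar>g x\<bar> \<le> B"
    and u: "\<And>n::nat. \<exists>H a. H \<subseteq> F \<and> H \<noteq> {} \<and> u n = tcomb G H a"
  obtains H s b c a where "H \<subseteq> F" "H \<noteq> {}" "strict_mono s"
    "\<And>n. u (s n) = tcomb G H (b n)" "\<And>g. g \<in> H \<Longrightarrow> (\<lambda>n. b n g - c n) \<longlonglongrightarrow> a g"
proof -
  have "\<exists>H a. H \<subseteq> F \<and> H \<noteq> {} \<and> u n = tcomb G H a \<and> (\<forall>g\<in>H. \<forall>g'\<in>H. \<bar>a g - a g'\<bar> \<le> 2 * B)" for n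
  proof -
    obtain H a where H: "H \<subseteq> F" "H \<noteq> {}" "u n = tcomb G H a" using u by blast
    have fin: "finite H" using F H finite_subset by blast
    define H' where "H' = {g \<in> H. \<exists>x\<in>pts G. tcomb G H a x = g x + a g}"
    obtain x where x: "x \<in> pts G" using assms(1) by blast
    have "H' \<noteq> {}" using tcomb_attained[OF fin H(2) x, of a] x unfolding H'_def by blast
    moreover have "u n = tcomb G H' a" using tcomb_drop_inactive[OF fin H(2), of G a] H(3) by (simp add: H'_def)
    moreover have half: "a g - a g' \<le> 2 * B" if "g \<in> H'" "g' \<in> H'" for g g'
    proof -
      obtain y where y: "y \<in> pts G" "tcomb G H a y = g y + a g" using \<open>g \<in> H'\<close> by (auto simp: H'_def)
      \<comment> \<open>Comparison where \<open>g\<close> attains the minimum: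
        \<open>a g - a g'\<close> is at most \<open>g' y - g y\<close>, whence the constant
        \<open>2 * B\<close>.\<close>
      have "g y + a g \<le> g' y + a g'" using tcomb_le[OF fin _ y(1), of g' a] y that by (simp add: H'_def)
      moreover have "\<bar>g y\<bar> \<le> B" "\<bar>g' y\<bar> \<le> B" using that H(1) y B by (auto simp: H'_def)
      ultimately show ?thesis by linarith
    qed
    then have "\<forall>g\<in>H'. \<forall>g'\<in>H'. \<bar>a g - a g'\<bar> \<le> 2 * B" by (simp add: abs_le_iff)
    moreover have "H' \<subseteq> F" using H by (auto simp: H'_def)
    ultimately show ?thesis by blast
  qed
  then obtain Hn an where Hn: "\<And>n. Hn n \<subseteq> F" "\<And>n. Hn n \<noteq> {}" "\<And>n. u n = tcomb G (Hn n) (an n)"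
    "\<And>n g g'. g \<in> Hn n \<Longrightarrow> g' \<in> Hn n \<Longrightarrow> \<bar>an n g - an n g'\<bar> \<le> 2 * B" by metis
  \<comment> \<open>\<open>F\<close> has finitely many subsets, so one of them serves for infinitely
    many \<open>n\<close>.\<close>
  have "\<exists>H\<in>Pow F. infinite {n \<in> UNIV. Hn n = H}"
    using Hn(1) F by (intro pigeonhole_infinite_rel) auto
  then obtain H where H: "H \<subseteq> F" "infinite {n. Hn n = H}" by auto
  obtain s1 :: "nat \<Rightarrow> nat" where s1: "strict_mono s1" "\<And>n. Hn (s1 n) = H"
    using infinite_enumerate[OF H(2)] by auto
  obtain g0 where g0: "g0 \<in> H" using Hn(2) s1(2) by (metis equals0I)
  \<comment> \<open>Only differences of coefficients are bounded, so a fixed member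
    \<open>g0\<close> serves as origin; its own coefficients become the shifts
    \<open>c\<close>.\<close>
  have "Bseq (\<lambda>n. an (s1 n) g - an (s1 n) g0)" if "g \<in> H" for g
    using Hn(4) s1(2) g0 that by (intro BseqI'[of _ "2 * B"]) auto
  then obtain s2 where s2: "strict_mono s2" "\<forall>g\<in>H. convergent (\<lambda>n. an (s1 (s2 n)) g - an (s1 (s2 n)) g0)"
    using finite_convergent_subsequence[of H "\<lambda>n g. an (s1 n) g - an (s1 n) g0"] H(1) F
    by (meson finite_subset)
  show ?thesis
  proof (rule that)
    show "H \<subseteq> F" "H \<noteq> {}" using H g0 by auto
    show "strict_mono (s1 \<circ> s2)" using s1 s2 by (simp add: strict_mono_o)
    show "u ((s1 \<circ> s2) n) = tcomb G H (an (s1 (s2 n)))" for n using Hn(3)[of "s1 (s2 n)"] s1(2) by simp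
    show "(\<lambda>n. an (s1 (s2 n)) g - an (s1 (s2 n)) g0) \<longlonglongrightarrow> lim (\<lambda>n. an (s1 (s2 n)) g - an (s1 (s2 n)) g0)"
      if "g \<in> H" for g using s2(2) that by (simp add: convergent_LIMSEQ_iff)
  qed
qed

lemma tcomb_tendsto:
  assumes H: "finite H" "H \<noteq> {}" and x: "x \<in> pts G" and b: "\<And>g. g \<in> H \<Longrightarrow> (\<lambda>n. b n g) \<longlonglongrightarrow> a g"
  shows "(\<lambda>n. tcomb G H (b n) x) \<longlonglongrightarrow> tcomb G H a x"
proof -
  have "(\<lambda>n. Min ((\<lambda>f. f x + b n f) ` H)) \<longlonglongrightarrow> Min ((\<lambda>f. f x + a f) ` H)"
    using H b
  proof (induction H rule: finite_ne_induct)
    case (insert g H)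
    have "(\<lambda>n. min (g x + b n g) (Min ((\<lambda>f. f x + b n f) ` H))) \<longlonglongrightarrow> min (g x + a g) (Min ((\<lambda>f. f x + a f) ` H))"
      using insert by (intro tendsto_min tendsto_add) auto
    then show ?case using insert by simp
  qed (auto intro!: tendsto_add)
  then show ?thesis using x by (simp add: tcomb_def)
qed

lemma tcomb_shift:
  assumes "finite H" "H \<noteq> {}" "x \<in> pts G"
  shows "tcomb G H (\<lambda>g. a g + c) x = tcomb G H a x + c"
proof -
  obtain g where g: "g \<in> H" "tcomb G H (\<lambda>g. a g + c) x = g x + (a g + c)" using tcomb_attained[OF assms] by blast
  obtain g' where g': "g' \<in> H" "tcomb G H a x = g' x + a g'" using tcomb_attained[OF assms] by blast
  show ?thesis using g g' tcomb_le[OF assms(1) g'(1) assms(3), of "\<lambda>g. a g + c"]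
      tcomb_le[OF assms(1) g(1) assms(3), of a] by linarith
qed

lemma tsubmoduleD:
  "tsubmodule G \<Sigma> \<Longrightarrow> H \<subseteq> \<Sigma> \<Longrightarrow> finite H \<Longrightarrow> H \<noteq> {} \<Longrightarrow> tcomb G H a \<in> \<Sigma>"
  by (simp add: tsubmodule_def)

lemma pts_nonempty: "wf_mgraph G \<Longrightarrow> pts G \<noteq> {}"
  by (force simp: wf_mgraph_def pts_def)

lemma common_bound:
  assumes "wf_mgraph G" "finite F" "F \<subseteq> PL G"
  shows "\<exists>B. \<forall>g\<in>F. \<forall>x\<in>pts G. \<bar>g x\<bar> \<le> B"
  using assms(2,3)
proof (induction F)
  case (insert g F)
  then obtain B where "\<forall>g\<in>F. \<forall>x\<in>pts G. \<bar>g x\<bar> \<le> B" by auto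
  moreover obtain B' where "\<forall>x\<in>pts G. \<bar>g x\<bar> \<le> B'" using PL_bounded[OF assms(1), of g] insert by blast
  ultimately show ?case by (intro exI[of _ "max B B'"]) (auto simp: le_max_iff_disj)
qed simp

text \<open>Compactness controls coefficients only up to the shifts \<open>c n\<close>. Convergence
  of the approximants at any point forces \<open>c\<close> to converge, and uniqueness of its limit
  shows that \<open>f\<close> differs from the limiting combination by one constant, which the
  coefficients absorb.\<close>

lemma fin_gen_sup_closed:
  assumes G: "wf_mgraph G" and "fin_gen G \<Sigma>" and ts: "tsubmodule G \<Sigma>" and PL: "\<Sigma> \<subseteq> PL G"
  shows "sup_closed G \<Sigma>"
  unfolding sup_closed_def
proof (intro ballI impI)
  fix f assume f: "f \<in> PL G" and approx: "\<forall>\<epsilon>>0. \<exists>g\<in>\<Sigma>. \<forall>x\<in>pts G. \<bar>g x - f x\<bar> < \<epsilon>"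
  obtain F where F: "finite F" "F \<subseteq> \<Sigma>" "\<Sigma> = {tcomb G H a | H a. H \<subseteq> F \<and> H \<noteq> {}}"
    using assms(2) by (auto simp: fin_gen_def)
  obtain B where B: "\<forall>g\<in>F. \<forall>x\<in>pts G. \<bar>g x\<bar> \<le> B"
    using common_bound[OF G F(1)] F(2) PL by blast
  have "\<exists>g\<in>\<Sigma>. \<forall>x\<in>pts G. \<bar>g x - f x\<bar> < inverse (real (Suc n))" for n
    using approx by (simp del: of_nat_Suc)
  then obtain u where u: "\<And>n. u n \<in> \<Sigma>" "\<And>n x. x \<in> pts G \<Longrightarrow> \<bar>u n x - f x\<bar> < inverse (real (Suc n))"
    by metis
  have u_lim: "(\<lambda>n. u n x) \<longlonglongrightarrow> f x" if "x \<in> pts G" for x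
  proof (rule LIM_zero_cancel, rule tendsto_0_le[where K = 1])
    show "(\<lambda>n. inverse (real (Suc n))) \<longlonglongrightarrow> 0" by (rule LIMSEQ_inverse_real_of_nat)
    show "\<forall>\<^sub>F n in sequentially. norm (u n x - f x) \<le> norm (inverse (real (Suc n))) * 1"
      using u(2)[OF that] by (intro always_eventually allI) (simp add: less_imp_le del: of_nat_Suc)
  qed
  have gen: "\<exists>H a. H \<subseteq> F \<and> H \<noteq> {} \<and> u n = tcomb G H a" for n
    using u(1)[of n] unfolding F(3) by blast
  obtain H s b c a where H: "H \<subseteq> F" "H \<noteq> {}" "strict_mono s" "\<And>n. u (s n) = tcomb G H (b n)"
    "\<And>g. g \<in> H \<Longrightarrow> (\<lambda>n. b n g - c n) \<longlonglongrightarrow> a g"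
    by (rule tcomb_compactness[where u = u, OF pts_nonempty[OF G] F(1) B gen]) (rule that)
  have fin: "finite H" using F(1) H(1) finite_subset by blast
  have c_lim: "c \<longlonglongrightarrow> f x - tcomb G H a x" if x: "x \<in> pts G" for x
  proof -
    have "(\<lambda>n. u (s n) x - tcomb G H (\<lambda>g. b n g - c n) x) \<longlonglongrightarrow> f x - tcomb G H a x"
      using LIMSEQ_subseq_LIMSEQ[OF u_lim[OF x] H(3)] tcomb_tendsto[OF fin H(2) x, of "\<lambda>n g. b n g - c n"] H(5)
      by (intro tendsto_diff) (auto simp: o_def)
    moreover have "u (s n) x - tcomb G H (\<lambda>g. b n g - c n) x = c n" for n
      using tcomb_shift[OF fin H(2) x, of "\<lambda>g. b n g - c n" "c n"] H(4)[of n] by simp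
    ultimately show ?thesis by simp
  qed
  obtain x0 where x0: "x0 \<in> pts G" using pts_nonempty[OF G] by blast
  define c' where "c' = f x0 - tcomb G H a x0"
  have "f x = tcomb G H (\<lambda>g. a g + c') x" for x
  proof (cases "x \<in> pts G")
    case True
    have "f x - tcomb G H a x = c'" using LIMSEQ_unique[OF c_lim[OF True] c_lim[OF x0]] by (simp add: c'_def)
    then show ?thesis using tcomb_shift[OF fin H(2) True, of a c'] by simp
  next
    case False
    then show ?thesis using f by (simp add: PL_def tcomb_def)
  qed
  then have "f = tcomb G H (\<lambda>g. a g + c')" by blast
  then show "f \<in> \<Sigma>" using tsubmoduleD[OF ts _ fin H(2)] H(1) F(2) by blast
qed

section \<open>Slope drops forced by points of the divisor along a ray\<close>

text \<open>Strictly decreasing integers fall by at least 1 per step. The total drop serves (BNRP),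
  the number of distinct values serves (LRP).\<close>

lemma decreasing_Ints:
  fixes v :: "nat \<Rightarrow> real"
  assumes "\<And>j. j \<le> k \<Longrightarrow> v j \<in> \<int>" and "\<And>j. j < k \<Longrightarrow> v (Suc j) < v j"
  shows "v k + real k \<le> v 0" and "card (v ` {..k}) = Suc k"
proof -
  have step: "v (Suc j) + 1 \<le> v j" if j: "j < k" for j
  proof -
    obtain m n :: int where "v (Suc j) = of_int m" "v j = of_int n"
      using assms(1)[of j] assms(1)[of "Suc j"] j by (auto elim!: Ints_cases)
    then show ?thesis using assms(2)[OF j] by simp
  qed
  have gap: "v j + real (j - i) \<le> v i" if "i \<le> j" "j \<le> k" for i j
    using that
  proof (induction j rule: dec_induct)
    case (step n)
    then show ?case using \<open>\<And>j. j < k \<Longrightarrow> v (Suc j) + 1 \<le> v j\<close>[of n] by (simp add: Suc_diff_le)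
  qed simp
  show "v k + real k \<le> v 0" using gap[of 0 k] by simp
  have "v j < v i" if "i < j" "j \<le> k" for i j using gap[of i j] that by simp
  then have "inj_on v {..k}"
    by (intro inj_onI) (metis atMost_iff less_irrefl linorder_neqE_nat)
  then show "card (v ` {..k}) = Suc k" by (simp add: card_image)
qed

text \<open>This is concavity of a minimum of affine functions, obtained by adding the two
  minimality inequalities at \<open>h\<close> and \<open>h'\<close>.\<close>

lemma active_slopes_antimono:
  assumes lin: "\<And>g h. g \<in> H \<Longrightarrow> 0 \<le> h \<Longrightarrow> h \<le> \<delta> \<Longrightarrow> g (ray G \<eta> h) = g (ray G \<eta> 0) + sl G g \<eta> * h"
    and h: "0 \<le> h" "h < h'" "h' \<le> \<delta>"
    and g: "g \<in> active H b (ray G \<eta> h)" "g' \<in> active H b (ray G \<eta> h')"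
  shows "sl G g' \<eta> \<le> sl G g \<eta>"
proof -
  have "g \<in> H" "g' \<in> H" using g by (auto simp: active_def)
  moreover have "g (ray G \<eta> h) + b g \<le> g' (ray G \<eta> h) + b g'"
    "g' (ray G \<eta> h') + b g' \<le> g (ray G \<eta> h') + b g" using g by (auto simp: active_def)
  ultimately have "(sl G g' \<eta> - sl G g \<eta>) * (h' - h) \<le> 0"
    using lin[of g h] lin[of g h'] lin[of g' h] lin[of g' h'] h by (simp add: algebra_simps)
  then show ?thesis using h by (simp add: mult_le_0_iff)
qed

text \<open>The onward and backward slopes add up to at most -1. Each is realised by an active
  generator, and a backward slope is the negative of the slope along \<open>\<eta>\<close>, so the
  generator realising the onward one has the smaller slope.\<close>

lemma divf_break:
  assumes G: "wf_mgraph G" and H: "finite H" "H \<noteq> {}" "H \<subseteq> PL G" and u: "tcomb G H b \<in> PL G"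
    and \<eta>: "\<eta> \<in> tangents G"
    and lin: "\<And>g h. g \<in> H \<Longrightarrow> 0 \<le> h \<Longrightarrow> h \<le> \<delta> \<Longrightarrow> g (ray G \<eta> h) = g (ray G \<eta> 0) + sl G g \<eta> * h"
    and int: "\<And>h. 0 < h \<Longrightarrow> h \<le> \<delta> \<Longrightarrow> ray G \<eta> h = In (fst \<eta>) (rpar \<eta> h) \<and>
      0 < rpar \<eta> h \<and> rpar \<eta> h < elen G (fst \<eta>)"
    and h: "0 < h" "h < \<delta>" and div: "divf G (tcomb G H b) (ray G \<eta> h) \<ge> 1"
  shows "\<exists>g\<in>active H b (ray G \<eta> h). \<exists>g'\<in>active H b (ray G \<eta> h). sl G g' \<eta> < sl G g \<eta>"
proof -
  let ?u = "tcomb G H b" and ?x = "ray G \<eta> h"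
  define \<eta>1 where "\<eta>1 = (fst \<eta>, rpar \<eta> h, snd (snd \<eta>))"
  define \<eta>2 where "\<eta>2 = (fst \<eta>, rpar \<eta> h, \<not> snd (snd \<eta>))"
  have "fst \<eta> \<in> edges G" using \<eta> by (auto simp: tangents_def)
  then have Tv: "Tv G ?x = {\<eta>1, \<eta>2}"
    using Tv_In[of "fst \<eta>" G "rpar \<eta> h" "snd (snd \<eta>)"] int h by (simp add: \<eta>1_def \<eta>2_def)
  have "\<eta>1 \<noteq> \<eta>2" by (simp add: \<eta>1_def \<eta>2_def)
  then have sum: "sl G ?u \<eta>1 + sl G ?u \<eta>2 \<le> - 1" using div by (simp add: divf_def Tv)
  obtain g' where g': "g' \<in> active H b ?x" "sl G ?u \<eta>1 = sl G g' \<eta>1"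
    using sl_tcomb(2)[OF G H u, of \<eta>1 ?x] Tv by auto
  obtain g where g: "g \<in> active H b ?x" "sl G ?u \<eta>2 = sl G g \<eta>2"
    using sl_tcomb(2)[OF G H u, of \<eta>2 ?x] Tv by auto
  have gH: "g \<in> H" "g' \<in> H" using g g' by (auto simp: active_def)
  have "sl G g' \<eta>1 = sl G g' \<eta>" "sl G g \<eta>2 = - sl G g \<eta>"
    using lin gH h unfolding \<eta>1_def \<eta>2_def
    by (auto intro!: sl_inside_ray[where \<delta> = \<delta>])
  then have "sl G g' \<eta> < sl G g \<eta>" using sum g g' by simp
  then show ?thesis using g g' by blast
qed

lemma break_chain:
  assumes G: "wf_mgraph G" and H: "finite H" "H \<noteq> {}" "H \<subseteq> PL G" and u: "tcomb G H b \<in> PL G"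
    and \<eta>: "\<eta> \<in> tangents G"
    and lin: "\<And>g h. g \<in> H \<Longrightarrow> 0 \<le> h \<Longrightarrow> h \<le> \<delta> \<Longrightarrow> g (ray G \<eta> h) = g (ray G \<eta> 0) + sl G g \<eta> * h"
    and int: "\<And>h. 0 < h \<Longrightarrow> h \<le> \<delta> \<Longrightarrow> ray G \<eta> h = In (fst \<eta>) (rpar \<eta> h) \<and>
      0 < rpar \<eta> h \<and> rpar \<eta> h < elen G (fst \<eta>)"
    and p: "\<And>j. j < k \<Longrightarrow> 0 < p j \<and> p j < \<delta>" "\<And>i j. i < j \<Longrightarrow> j < k \<Longrightarrow> p i < p j"
    and div: "\<And>j. j < k \<Longrightarrow> divf G (tcomb G H b) (ray G \<eta> (p j)) \<ge> 1"
    and k: "k > 0"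
  obtains v where "\<And>j. j \<le> k \<Longrightarrow> \<exists>i<k. \<exists>g\<in>active H b (ray G \<eta> (p i)). v j = sl G g \<eta>"
    "\<And>j. j < k \<Longrightarrow> v (Suc j) < v j"
proof -
  have "\<exists>g\<in>active H b (ray G \<eta> (p j)). \<exists>g'\<in>active H b (ray G \<eta> (p j)). sl G g' \<eta> < sl G g \<eta>" if "j < k" for j
    using p(1)[OF that] div[OF that] by (intro divf_break[OF G H u \<eta> lin int]) auto
  then obtain g g' where g: "\<And>j. j < k \<Longrightarrow> g j \<in> active H b (ray G \<eta> (p j))"
    "\<And>j. j < k \<Longrightarrow> g' j \<in> active H b (ray G \<eta> (p j))" "\<And>j. j < k \<Longrightarrow> sl G (g' j) \<eta> < sl G (g j) \<eta>"
    by metis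
  \<comment> \<open>The larger slope at each break, closed off by the smaller slope at the last one:
    \<open>k\<close> breaks give \<open>k + 1\<close> values. Between consecutive breaks concavity
    prevents any increase.\<close>
  define v where "v j = (if j < k then sl G (g j) \<eta> else sl G (g' (k - 1)) \<eta>)" for j
  show ?thesis
  proof (rule that[of v])
    fix j assume "j \<le> k"
    show "\<exists>i<k. \<exists>g\<in>active H b (ray G \<eta> (p i)). v j = sl G g \<eta>"
    proof (cases "j < k")
      case True
      then show ?thesis using g(1) by (auto simp: v_def)
    next
      case False
      then show ?thesis using g(2)[of "k - 1"] k by (intro exI[of _ "k - 1"]) (auto simp: v_def)
    qed
  next
    fix j assume j: "j < k"
    show "v (Suc j) < v j"
    proof (cases "Suc j < k")
      case True
      have "0 \<le> p j" "p j < p (Suc j)" "p (Suc j) \<le> \<delta>"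
        using p(1)[OF j] p(1)[OF True] p(2)[OF _ True, of j] by auto
      then have "sl G (g (Suc j)) \<eta> \<le> sl G (g' j) \<eta>"
        using active_slopes_antimono[OF lin _ _ _ g(2)[OF j] g(1)[OF True]] by blast
      then show ?thesis using g(3)[OF j] True j by (simp add: v_def)
    next
      case False
      then have "k - 1 = j" using j by simp
      then show ?thesis using g(3)[OF j] False j by (simp add: v_def)
    qed
  qed
qed

section \<open>Passage to the limit at a point\<close>

text \<open>A generator inactive in the limit loses by a positive margin, which persists for late
  \<open>n\<close>; the shift \<open>c n\<close> cancels in the comparison.\<close>

lemma active_eventually_subset:
  assumes "finite H" and b: "\<And>g. g \<in> H \<Longrightarrow> (\<lambda>n. b n g - c n) \<longlonglongrightarrow> a g"
    and y: "\<And>g. g \<in> H \<Longrightarrow> (\<lambda>n. g (y n)) \<longlonglongrightarrow> g x"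
  shows "eventually (\<lambda>n. active H (b n) (y n) \<subseteq> active H a x) sequentially"
proof -
  have "eventually (\<lambda>n. g \<notin> active H (b n) (y n)) sequentially" if g: "g \<in> H - active H a x" for g
  proof -
    obtain g' where g': "g' \<in> H" "g' x + a g' < g x + a g" using g by (force simp: active_def)
    have "(\<lambda>n. (g (y n) + (b n g - c n)) - (g' (y n) + (b n g' - c n))) \<longlonglongrightarrow> (g x + a g) - (g' x + a g')"
      using g g' b y by (intro tendsto_diff tendsto_add) auto
    then have "eventually (\<lambda>n. (g (y n) + (b n g - c n)) - (g' (y n) + (b n g' - c n)) > 0) sequentially"
      using g'(2) by (intro order_tendstoD(1)) auto
    then show ?thesis by eventually_elim (use g'(1) in \<open>force simp: active_def\<close>)
  qed
  then have "eventually (\<lambda>n. \<forall>g\<in>H - active H a x. g \<notin> active H (b n) (y n)) sequentially"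
    using assms(1) by (intro eventually_ball_finite) auto
  then show ?thesis by eventually_elim (auto simp: active_def)
qed

text \<open>As the break points of the approximating functions tend to \<open>x\<close>, the generators realising
  the slopes around them stay active at \<open>x\<close> in the limit.  They supply \<open>k + 1\<close> slopes along \<open>\<eta>\<close>, and
  their top slope exceeds that of the limit by at least \<open>k\<close>.\<close>

lemma limit_at_point:
  assumes G: "wf_mgraph G" and H: "finite H" "H \<noteq> {}" "H \<subseteq> PL G" and f: "tcomb G H a \<in> PL G"
    and \<eta>: "\<eta> \<in> Tv G x" and finT: "finite (Tv G x)" and \<delta>: "\<delta> > 0"
    and lin: "\<And>g h. g \<in> H \<Longrightarrow> 0 \<le> h \<Longrightarrow> h \<le> \<delta> \<Longrightarrow> g (ray G \<eta> h) = g (ray G \<eta> 0) + sl G g \<eta> * h"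
    and int: "\<And>h. 0 < h \<Longrightarrow> h \<le> \<delta> \<Longrightarrow> ray G \<eta> h = In (fst \<eta>) (rpar \<eta> h) \<and>
      0 < rpar \<eta> h \<and> rpar \<eta> h < elen G (fst \<eta>)"
    and b: "\<And>g. g \<in> H \<Longrightarrow> (\<lambda>n. b n g - c n) \<longlonglongrightarrow> a g"
    and u: "\<And>n. tcomb G H (b n) \<in> PL G"
    and p: "\<And>n j. j < k \<Longrightarrow> 0 < p n j \<and> p n j < \<delta>" "\<And>n i j. i < j \<Longrightarrow> j < k \<Longrightarrow> p n i < p n j"
    and p0: "\<And>j. j < k \<Longrightarrow> (\<lambda>n. p n j) \<longlonglongrightarrow> 0"
    and div: "\<And>n j. j < k \<Longrightarrow> divf G (tcomb G H (b n)) (ray G \<eta> (p n j)) \<ge> 1"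
    and divx: "\<And>n. d + divf G (tcomb G H (b n)) x \<ge> 0"
    and k: "k > 0"
  shows "d + divf G (tcomb G H a) x \<ge> real k"
    and "card ((\<lambda>g. sl G g \<eta>) ` active H a x) \<ge> Suc k"
proof -
  let ?f = "tcomb G H a"
  have \<eta>t: "\<eta> \<in> tangents G" and x: "ray G \<eta> 0 = x"
    using \<eta> ray_zero_Tv[OF \<eta>] by (auto simp: Tv_def)
  have "eventually (\<lambda>n. active H (b n) (ray G \<eta> (p n j)) \<subseteq> active H a x) sequentially" if j: "j < k" for j
  proof (intro active_eventually_subset[OF H(1) b])
    fix g assume g: "g \<in> H"
    have "(\<lambda>n. g x + sl G g \<eta> * p n j) \<longlonglongrightarrow> g x + sl G g \<eta> * 0"
      by (intro tendsto_intros p0 j)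
    moreover have "g (ray G \<eta> (p n j)) = g x + sl G g \<eta> * p n j" for n
      using lin[OF g, of "p n j"] p(1)[OF j, of n] x by simp
    ultimately show "(\<lambda>n. g (ray G \<eta> (p n j))) \<longlonglongrightarrow> g x" by simp
  qed
  then have "eventually (\<lambda>n. \<forall>j\<in>{..<k}. active H (b n) (ray G \<eta> (p n j)) \<subseteq> active H a x) sequentially"
    by (intro eventually_ball_finite) auto
  moreover have "eventually (\<lambda>n. active H (b n) x \<subseteq> active H a x) sequentially"
    by (intro active_eventually_subset[OF H(1) b]) auto
  ultimately have "eventually (\<lambda>n. (\<forall>j\<in>{..<k}. active H (b n) (ray G \<eta> (p n j)) \<subseteq> active H a x) \<and>
      active H (b n) x \<subseteq> active H a x) sequentially" by (rule eventually_conj)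
  \<comment> \<open>One sufficiently late \<open>n\<close> suffices from here on: both conclusions
    are read off the inclusions of active sets.\<close>
  then obtain n where n: "\<And>j. j < k \<Longrightarrow> active H (b n) (ray G \<eta> (p n j)) \<subseteq> active H a x"
    "active H (b n) x \<subseteq> active H a x"
    by (auto dest!: eventually_happens'[OF sequentially_bot])
  let ?u = "tcomb G H (b n)"
  obtain v where v: "\<And>j. j \<le> k \<Longrightarrow> \<exists>i<k. \<exists>g\<in>active H (b n) (ray G \<eta> (p n i)). v j = sl G g \<eta>"
    "\<And>j. j < k \<Longrightarrow> v (Suc j) < v j"
    using break_chain[where p = "p n", OF G H u[of n] \<eta>t lin int p div k] by blast
  have vact: "v j \<in> (\<lambda>g. sl G g \<eta>) ` active H a x" if "j \<le> k" for j using v(1)[OF that] n(1) by blast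
  have vint: "v j \<in> \<int>" if "j \<le> k" for j
    using v(1)[OF that] PL_linear_on_ray(2)[OF _ \<eta>t] H(3) by (auto simp: active_def)
  have "finite (active H a x)" using H(1) by (simp add: active_def)
  then have "card (v ` {..k}) \<le> card ((\<lambda>g. sl G g \<eta>) ` active H a x)"
    using vact by (intro card_mono) auto
  then show "card ((\<lambda>g. sl G g \<eta>) ` active H a x) \<ge> Suc k"
    using decreasing_Ints(2)[of k v, OF vint v(2)] by simp
  \<comment> \<open>The active set at \<open>x\<close> can only grow in the limit, so the least
    active slope can only fall.\<close>
  have ge: "sl G ?f \<xi> \<le> sl G ?u \<xi>" if \<xi>: "\<xi> \<in> Tv G x" for \<xi>
    using sl_tcomb(2)[OF G H u[of n] \<xi>] sl_tcomb(1)[OF G H f \<xi>] n(2) by force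
  have "sl G ?f \<eta> + real k \<le> sl G ?u \<eta>"
  proof -
    obtain g where g: "g \<in> active H (b n) (ray G \<eta> 0)" "sl G ?u \<eta> = sl G g \<eta>"
      using sl_tcomb(2)[OF G H u[of n] \<eta>] x by auto
    obtain i g0 where i: "i < k" and g0: "g0 \<in> active H (b n) (ray G \<eta> (p n i))" "v 0 = sl G g0 \<eta>"
      using v(1)[of 0] by auto
    \<comment> \<open>The base point precedes every break, so by concavity the slope there dominates
      the whole chain, while \<open>v k\<close> still bounds the slope of the limit from
      above.\<close>
    have "v 0 \<le> sl G g \<eta>"
      using active_slopes_antimono[OF lin _ _ _ g(1) g0(1)] p(1)[OF i, of n] g0(2) by simp
    moreover have "v k + real k \<le> v 0" using decreasing_Ints(1)[of k v, OF vint v(2)] by simp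
    moreover have "sl G ?f \<eta> \<le> v k" using vact[of k] sl_tcomb(1)[OF G H f \<eta>] by auto
    ultimately show ?thesis using g(2) by linarith
  qed
  \<comment> \<open>No other direction can offset the drop along \<open>\<eta>\<close>, so
    \<open>divf\<close> at \<open>x\<close> gains at least \<open>k\<close>.\<close>
  moreover have "(\<Sum>\<xi>\<in>Tv G x - {\<eta>}. sl G ?f \<xi>) \<le> (\<Sum>\<xi>\<in>Tv G x - {\<eta>}. sl G ?u \<xi>)"
    using ge by (intro sum_mono) auto
  ultimately have "(\<Sum>\<xi>\<in>Tv G x. sl G ?f \<xi>) + real k \<le> (\<Sum>\<xi>\<in>Tv G x. sl G ?u \<xi>)"
    using sum.remove[OF finT \<eta>, of "sl G ?f"] sum.remove[OF finT \<eta>, of "sl G ?u"] by simp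
  then show "d + divf G ?f x \<ge> real k" using divx[of n] by (simp add: divf_def)
qed

section \<open>From slopes to ranks in permutation arrays\<close>

lemma finite_cube: "finite (cube r d)"
proof (rule finite_subset)
  show "cube r d \<subseteq> {f. \<forall>x. (x \<in> {..<d} \<longrightarrow> f x \<in> {..r}) \<and> (x \<notin> {..<d} \<longrightarrow> f x = 0)}"
    by (auto simp: cube_def)
  show "finite {f. \<forall>x. (x \<in> {..<d} \<longrightarrow> f x \<in> {..r}) \<and> (x \<notin> {..<d} \<longrightarrow> f x = (0::nat))}"
    by (intro finite_set_of_finite_funs) auto
qed

text \<open>Each coordinate of a meet is attained by a member, which dominates the meet elsewhere.
  Thus index vectors in the closure may be counted by a rank that only sees
  \<open>P\<close>.\<close>

lemma pclosure_coord:
  assumes "y \<in> pclosure d P" "i < d"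
  obtains y' where "y' \<in> P" "y' i = y i" "\<And>j. j < d \<Longrightarrow> y j \<le> y' j"
proof -
  have "\<exists>y'\<in>P. y' i = y i \<and> (\<forall>j<d. y j \<le> y' j)"
  proof (cases "y \<in> P")
    case False
    then obtain H where H: "H \<subseteq> P" "card H \<ge> 2" "y = meet d H"
      using assms(1) by (auto simp: pclosure_def redundant_def)
    have fin: "finite H" "H \<noteq> {}" using H(2) card.infinite by fastforce+
    then have "Min ((\<lambda>h. h i) ` H) \<in> (\<lambda>h. h i) ` H" by (intro Min_in) auto
    then obtain h where h: "h \<in> H" "h i = y i" using H(3) assms(2) by (auto simp: meet_def)
    then show ?thesis using H fin by (intro bexI[of _ h]) (auto simp: meet_def)
  qed auto
  then show ?thesis using that by blast
qed

lemma rank_array_ge: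
  assumes P: "totally_rankable r d P" and z: "z \<in> cube r d" and i: "i < d"
    and Q: "Q \<subseteq> pclosure d P" "\<And>y j. y \<in> Q \<Longrightarrow> j < d \<Longrightarrow> z j \<le> y j"
    and m: "m \<le> card ((\<lambda>y. y i) ` Q)"
  shows "int m - 1 \<le> rank_array d P z"
proof -
  obtain s where s: "rankable d (above d P z) s" using P z by (auto simp: totally_rankable_def)
  \<comment> \<open>The coordinate \<open>i < d\<close> pins down the \<open>THE\<close> in
    \<open>prank\<close>; in dimension 0 every \<open>s\<close> would qualify.\<close>
  then have "rank_array d P z = s"
    unfolding rank_array_def prank_def using i by (intro the_equality) (auto simp: rankable_def)
  moreover have "int (card ((\<lambda>y. y i) ` above d P z)) = s + 1" using s i by (auto simp: rankable_def)
  moreover have "(\<lambda>y. y i) ` Q \<subseteq> (\<lambda>y. y i) ` above d P z"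
  proof
    fix q assume "q \<in> (\<lambda>y. y i) ` Q"
    then obtain y where y: "y \<in> Q" "q = y i" by blast
    then obtain y' where "y' \<in> P" "y' i = y i" "\<And>j. j < d \<Longrightarrow> y j \<le> y' j"
      using pclosure_coord[of y d P i] Q(1) i by blast
    then show "q \<in> (\<lambda>y. y i) ` above d P z"
      using Q(2)[OF y(1)] y(2) by (intro image_eqI[of _ _ y']) (auto simp: above_def intro: order_trans)
  qed
  moreover have "finite (above d P z)"
    using P finite_cube[of r d] by (auto simp: totally_rankable_def above_def intro: finite_subset)
  ultimately show ?thesis using m card_mono[of "(\<lambda>y. y i) ` above d P z" "(\<lambda>y. y i) ` Q"] by simp
qed

lemma slope_structure_le_iff:
  assumes "slope_structure G r V S ord P" "\<eta> \<in> tangents G" "i \<le> r" "j \<le> r"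
  shows "S \<eta> i \<le> S \<eta> j \<longleftrightarrow> i \<le> j"
proof -
  have "S \<eta> i < S \<eta> j" if "i < j" "j \<le> r" for i j using assms(1,2) that by (simp add: slope_structure_def)
  from this[of i j] this[of j i] assms(3,4) show ?thesis
    by (cases i j rule: linorder_cases) auto
qed

lemma idxvec_slope:
  assumes ss: "slope_structure G r V S ord P" and f: "compatible G r S ord P f" and x: "x \<in> pts G" and j: "j < val G x"
  shows "idxvec G r S ord x f j \<le> r \<and> sl G f (ord x j) = real_of_int (S (ord x j) (idxvec G r S ord x f j))"
proof -
  have "bij_betw (ord x) {..<val G x} (Tv G x)" using ss x by (simp add: slope_structure_def)
  from bij_betwE[OF this] have t: "ord x j \<in> tangents G" using j by (simp add: Tv_def)
  then obtain i where i: "i \<le> r" "sl G f (ord x j) = real_of_int (S (ord x j) i)"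
    using f unfolding compatible_def by blast
  have "i' = i" if "i' \<le> r" "sl G f (ord x j) = real_of_int (S (ord x j) i')" for i'
    using that i slope_structure_le_iff[OF ss t, of i i'] slope_structure_le_iff[OF ss t, of i' i]
    by simp
  then have "idxvec G r S ord x f j = i"
    unfolding idxvec_def if_P[OF j] using i by (intro the_equality conjI) auto
  then show ?thesis using i by simp
qed

lemma idxvec_cube:
  assumes "slope_structure G r V S ord P" and "compatible G r S ord P f" and "x \<in> pts G"
  shows "idxvec G r S ord x f \<in> cube r (val G x)"
  using idxvec_slope[OF assms] by (auto simp: cube_def idxvec_def)

lemma idxvec_mono:
  assumes ss: "slope_structure G r V S ord P" and f: "compatible G r S ord P f" "compatible G r S ord P g"
    and x: "x \<in> pts G" and j: "j < val G x" and le: "sl G f (ord x j) \<le> sl G g (ord x j)"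
  shows "idxvec G r S ord x f j \<le> idxvec G r S ord x g j"
proof -
  have "bij_betw (ord x) {..<val G x} (Tv G x)" using ss x by (simp add: slope_structure_def)
  from bij_betwE[OF this] have "ord x j \<in> tangents G" using j by (simp add: Tv_def)
  from slope_structure_le_iff[OF ss this] show ?thesis
    using idxvec_slope[OF ss f(1) x j] idxvec_slope[OF ss f(2) x j] le by simp
qed

text \<open>Larger slopes mean larger indices, so the members of \<open>Q\<close> have index vectors
  above that of \<open>f\<close>; distinct slopes along \<open>\<eta>\<close> are distinct values of
  a single coordinate.\<close>

lemma rho_v_ge:
  assumes ss: "slope_structure G r V S ord P" and x: "x \<in> pts G" and \<eta>: "\<eta> \<in> Tv G x"
    and f: "compatible G r S ord P f" and Q: "finite Q" "\<And>g. g \<in> Q \<Longrightarrow> compatible G r S ord P g"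
    and le: "\<And>g \<xi>. g \<in> Q \<Longrightarrow> \<xi> \<in> Tv G x \<Longrightarrow> sl G f \<xi> \<le> sl G g \<xi>"
    and card: "m \<le> card ((\<lambda>g. sl G g \<eta>) ` Q)"
  shows "int m - 1 \<le> rho_v G r S ord P x f"
proof -
  have bij: "bij_betw (ord x) {..<val G x} (Tv G x)" using ss x by (simp add: slope_structure_def)
  then have "\<eta> \<in> ord x ` {..<val G x}" using \<eta> by (simp add: bij_betw_def)
  then obtain i where i: "i < val G x" "ord x i = \<eta>" by blast
  let ?I = "idxvec G r S ord x"
  have "(\<lambda>g. sl G g \<eta>) ` Q = (\<lambda>l. real_of_int (S \<eta> l)) ` (\<lambda>y. y i) ` ?I ` Q"
    unfolding image_image using idxvec_slope[OF ss Q(2) x i(1)] i(2) by (intro image_cong refl) simp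
  then have m: "m \<le> card ((\<lambda>y. y i) ` ?I ` Q)"
    using card card_image_le[of "(\<lambda>y. y i) ` ?I ` Q" "\<lambda>l. real_of_int (S \<eta> l)"] Q(1) by simp
  have "totally_rankable r (val G x) (P x)" using ss x by (simp add: slope_structure_def perm_array_def)
  moreover have "?I ` Q \<subseteq> pclosure (val G x) (P x)"
    using Q(2) x unfolding compatible_def by blast
  moreover have "?I f j \<le> y j" if y: "y \<in> ?I ` Q" and j: "j < val G x" for y j
  proof -
    obtain g where g: "g \<in> Q" "y = ?I g" using y by blast
    have "ord x j \<in> Tv G x" using bij_betwE[OF bij] j by simp
    then show ?thesis using idxvec_mono[OF ss f Q(2)[OF g(1)] x j le[OF g(1)]] g(2) by simp
  qed
  ultimately show ?thesis unfolding rho_v_def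
    by (rule rank_array_ge[OF _ idxvec_cube[OF ss f x] i(1) _ _ m])
qed

section \<open>Moving the divisor and assembling the limit\<close>

lemma Tv_nonempty:
  assumes G: "wf_mgraph G" and x: "x \<in> pts G"
  shows "Tv G x \<noteq> {}"
proof -
  consider v where "v \<in> verts G" "x = Vt v"
    | e t where "e \<in> edges G" "0 < t" "t < elen G e" "x = In e t" using x by (auto simp: pts_def)
  then show ?thesis
  proof cases
    case 1
    obtain e where e: "e \<in> edges G" "src G e \<in> verts G" using G by (auto simp: wf_mgraph_def)
    \<comment> \<open>A path from \<open>v\<close> to an end of some edge is either trivial or
      starts with an edge at \<open>v\<close>; either way \<open>v\<close> is not isolated.\<close>
    have "(adj G)\<^sup>*\<^sup>* v (src G e)" using G 1 e by (simp add: wf_mgraph_def)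
    then obtain e' where e': "e' \<in> edges G" "src G e' = v \<or> tgt G e' = v"
      using e by (cases rule: converse_rtranclpE) (auto simp: adj_def)
    have "elen G e' > 0" using G e' by (auto simp: wf_mgraph_def)
    then have "(e', 0, True) \<in> Tv G x \<or> (e', elen G e', False) \<in> Tv G x"
      using e' 1 by (auto simp: Tv_def tangents_def epar_def)
    then show ?thesis by blast
  next
    case 2
    then show ?thesis using Tv_In[of e G t True] by simp
  qed
qed

text \<open>Rays from different points may run along the same edge and meet. Counting fibres of
  \<open>q\<close> keeps the degree right despite such coincidences.\<close>

lemma point_count_effective:
  assumes I: "finite I" and q: "q ` I \<subseteq> pts G"
  defines "E \<equiv> \<lambda>y. int (card {i \<in> I. q i = y})"
  shows "effective G E" and "deg E = int (card I)" and "\<And>i. i \<in> I \<Longrightarrow> E (q i) \<ge> 1"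
proof -
  have supp: "{y. E y \<noteq> 0} = q ` I" using I by (auto simp: E_def card_eq_0_iff)
  then show "effective G E" using I q by (simp add: effective_def divisor_def) (simp add: E_def)
  have "deg E = (\<Sum>y\<in>q ` I. int (\<Sum>i\<in>{i \<in> I. q i = y}. 1))"
    unfolding deg_def supp by (simp add: E_def)
  also have "\<dots> = int (\<Sum>y\<in>q ` I. \<Sum>i\<in>{i \<in> I. q i = y}. 1)" by simp
  also have "\<dots> = int (card I)" using I by (subst sum.group) auto
  finally show "deg E = int (card I)" .
  show "E (q i) \<ge> 1" if "i \<in> I" for i
  proof -
    have "{i' \<in> I. q i' = q i} \<noteq> {}" using that by blast
    then have "card {i' \<in> I. q i' = q i} > 0" using I by (simp add: card_gt_0_iff)
    then show ?thesis by (simp add: E_def)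
  qed
qed

lemma good_ray:
  assumes "finite F" "F \<subseteq> PL G" "\<eta> \<in> tangents G" "finite X"
  shows "\<exists>\<delta>>0. (\<forall>g\<in>F. \<forall>h. 0 \<le> h \<and> h \<le> \<delta> \<longrightarrow> g (ray G \<eta> h) = g (ray G \<eta> 0) + sl G g \<eta> * h) \<and>
    (\<forall>h. 0 < h \<and> h \<le> \<delta> \<longrightarrow> ray G \<eta> h = In (fst \<eta>) (rpar \<eta> h) \<and>
      0 < rpar \<eta> h \<and> rpar \<eta> h < elen G (fst \<eta>)) \<and>
    (\<forall>h. 0 < h \<and> h \<le> \<delta> \<longrightarrow> ray G \<eta> h \<notin> X)"
proof -
  obtain \<delta>1 where 1: "\<delta>1 > 0"
    "\<forall>g\<in>F. \<forall>h. 0 \<le> h \<and> h \<le> \<delta>1 \<longrightarrow> g (ray G \<eta> h) = g (ray G \<eta> 0) + sl G g \<eta> * h"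
    using finite_PL_linear_on_ray[OF assms(1-3)] by blast
  obtain \<delta>2 where 2: "\<delta>2 > 0" "\<forall>h. 0 < h \<and> h \<le> \<delta>2 \<longrightarrow> ray G \<eta> h = In (fst \<eta>) (rpar \<eta> h) \<and>
      0 < rpar \<eta> h \<and> rpar \<eta> h < elen G (fst \<eta>)"
    using ray_interior[OF assms(3)] by blast
  obtain \<delta>3 where 3: "\<delta>3 > 0" "\<forall>h. 0 < h \<and> h \<le> \<delta>3 \<longrightarrow> ray G \<eta> h \<notin> X"
    using ray_avoids_finite[OF assms(3,4)] by blast
  define \<delta> where "\<delta> = min \<delta>1 (min \<delta>2 \<delta>3)"
  have le: "h \<le> \<delta>1 \<and> h \<le> \<delta>2 \<and> h \<le> \<delta>3" if "h \<le> \<delta>" for h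
    using that by (auto simp: \<delta>_def)
  moreover have "\<delta> > 0" using 1(1) 2(1) 3(1) by (simp add: \<delta>_def)
  ultimately show ?thesis using 1(2) 2(2) 3(2) by (intro exI[of _ \<delta>]) (blast dest: le)
qed

lemma structured_bnrp_lrp:
  assumes G: "wf_mgraph G" and tls: "trop_lin_series G r D \<Sigma>"
    and ss: "slope_structure G r V S ord P" and RS: "\<Sigma> \<subseteq> RS G r S ord P"
    and E: "effective G E" "deg E = int r"
  shows "\<exists>f\<in>\<Sigma>. bnrp G D E f \<and> lrp G r S ord P E f"
proof -
  have tsub: "tsubmodule G \<Sigma>" and RD: "\<Sigma> \<subseteq> RD G D" and finD: "finite {x. D x \<noteq> 0}"
    and BN: "\<And>E. effective G E \<Longrightarrow> deg E = int r \<Longrightarrow> \<exists>f\<in>\<Sigma>. bnrp G D E f"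
    using tls by (auto simp: trop_lin_series_def divisor_def)
  have PL: "\<Sigma> \<subseteq> PL G" and comp: "\<And>f. f \<in> \<Sigma> \<Longrightarrow> compatible G r S ord P f" using RS by (auto simp: RS_def)
  obtain F where F: "finite F" "F \<subseteq> \<Sigma>" "\<Sigma> = {tcomb G H a | H a. H \<subseteq> F \<and> H \<noteq> {}}"
    using tls by (auto simp: trop_lin_series_def fin_gen_def)
  define X where "X = {x. E x \<noteq> 0}"
  have X: "finite X" "X \<subseteq> pts G" using E(1) by (auto simp: X_def effective_def divisor_def)
  have Epos: "E x \<ge> 0" for x using E(1) by (simp add: effective_def)
  have "\<forall>x\<in>pts G. \<exists>\<xi>. \<xi> \<in> Tv G x" using Tv_nonempty[OF G] by blast
  from bchoice[OF this] obtain \<eta> where \<eta>: "\<And>x. x \<in> pts G \<Longrightarrow> \<eta> x \<in> Tv G x" by blast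
  then have \<eta>t: "\<And>x. x \<in> pts G \<Longrightarrow> \<eta> x \<in> tangents G" by (auto simp: Tv_def)
  have "\<forall>x\<in>pts G. \<exists>\<delta>>0. (\<forall>g\<in>F. \<forall>h. 0 \<le> h \<and> h \<le> \<delta> \<longrightarrow> g (ray G (\<eta> x) h) = g (ray G (\<eta> x) 0) + sl G g (\<eta> x) * h) \<and>
    (\<forall>h. 0 < h \<and> h \<le> \<delta> \<longrightarrow> ray G (\<eta> x) h = In (fst (\<eta> x)) (rpar (\<eta> x) h) \<and>
      0 < rpar (\<eta> x) h \<and> rpar (\<eta> x) h < elen G (fst (\<eta> x))) \<and>
    (\<forall>h. 0 < h \<and> h \<le> \<delta> \<longrightarrow> ray G (\<eta> x) h \<notin> {x. D x \<noteq> 0})"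
    using good_ray[OF F(1) _ \<eta>t finD] F(2) PL by blast
  from bchoice[OF this] obtain \<delta> where \<delta>: "\<And>x. x \<in> pts G \<Longrightarrow> \<delta> x > 0"
    and lin: "\<And>x g h. x \<in> pts G \<Longrightarrow> g \<in> F \<Longrightarrow> 0 \<le> h \<Longrightarrow> h \<le> \<delta> x \<Longrightarrow>
      g (ray G (\<eta> x) h) = g (ray G (\<eta> x) 0) + sl G g (\<eta> x) * h"
    and int: "\<And>x h. x \<in> pts G \<Longrightarrow> 0 < h \<Longrightarrow> h \<le> \<delta> x \<Longrightarrow> ray G (\<eta> x) h = In (fst (\<eta> x)) (rpar (\<eta> x) h) \<and>
      0 < rpar (\<eta> x) h \<and> rpar (\<eta> x) h < elen G (fst (\<eta> x))"
    and D0: "\<And>x h. x \<in> pts G \<Longrightarrow> 0 < h \<Longrightarrow> h \<le> \<delta> x \<Longrightarrow> D (ray G (\<eta> x) h) = 0"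
    by blast
  define k where "k x = nat (E x)" for x
  \<comment> \<open>The fractions \<open>(j + 1) / (k x + 1)\<close> are increasing in
    \<open>j\<close> and below 1 for \<open>j < k x\<close>; the last factor shrinks the whole
    pattern to \<open>x\<close>.\<close>
  define p where "p x n j = \<delta> x * (real (Suc j) / real (Suc (k x))) * inverse (real (Suc n))" for x n j
  have p: "0 < p x n j \<and> p x n j < \<delta> x" if "x \<in> pts G" "j < k x" for x n j
  proof -
    have "real (Suc j) / real (Suc (k x)) < 1" using that(2) by (simp add: field_simps)
    moreover have "inverse (real (Suc n)) \<le> 1" by (simp add: field_simps)
    ultimately have "(real (Suc j) / real (Suc (k x))) * inverse (real (Suc n)) < 1 * 1"
      by (intro mult_less_le_imp_less) auto
    then have "\<delta> x * ((real (Suc j) / real (Suc (k x))) * inverse (real (Suc n))) < \<delta> x * 1"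
      using \<delta>[OF that(1)] by (intro mult_strict_left_mono) auto
    moreover have "0 < p x n j" unfolding p_def using \<delta>[OF that(1)] by (intro mult_pos_pos divide_pos_pos) auto
    ultimately show ?thesis by (simp add: p_def mult.assoc)
  qed
  have p_mono: "p x n i < p x n j" if "x \<in> pts G" "i < j" for x n i j
    unfolding p_def using \<delta>[OF that(1)] that(2)
    by (intro mult_strict_right_mono mult_strict_left_mono divide_strict_right_mono) auto
  have p_lim: "(\<lambda>n. p x n j) \<longlonglongrightarrow> 0" for x j
    unfolding p_def by (rule tendsto_mult_right_zero[OF LIMSEQ_inverse_real_of_nat])
  define I where "I = Sigma X (\<lambda>x. {..<k x})"
  define q where "q n i = ray G (\<eta> (fst i)) (p (fst i) n (snd i))" for n i
  define En where "En n = (\<lambda>y. int (card {i \<in> I. q n i = y}))" for n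
  have I: "finite I" using X by (simp add: I_def)
  have "int (card I) = (\<Sum>x\<in>X. int (k x))" using X by (simp add: I_def)
  also have "\<dots> = deg E" unfolding deg_def X_def using Epos by (simp add: k_def)
  finally have cardI: "int (card I) = int r" using E(2) by simp
  have q: "q n ` I \<subseteq> pts G" for n
  proof
    fix y assume "y \<in> q n ` I"
    then obtain x j where xj: "x \<in> X" "j < k x" "y = ray G (\<eta> x) (p x n j)" by (auto simp: I_def q_def)
    then have "x \<in> pts G" using X by blast
    then show "y \<in> pts G" using xj int p In_ray_pts[OF \<eta>t] by (metis less_imp_le)
  qed
  note En = point_count_effective[OF I q, folded En_def]
  have "\<exists>f\<in>\<Sigma>. bnrp G D (En n) f" for n using BN[OF En(1)] En(2) cardI by metis
  then obtain u where u: "\<And>n. u n \<in> \<Sigma>" "\<And>n. bnrp G D (En n) (u n)" by metis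
  obtain B where B: "\<forall>g\<in>F. \<forall>x\<in>pts G. \<bar>g x\<bar> \<le> B"
    using common_bound[OF G F(1)] F(2) PL by blast
  have gen: "\<exists>H a. H \<subseteq> F \<and> H \<noteq> {} \<and> u n = tcomb G H a" for n
    using u(1)[of n] unfolding F(3) by blast
  obtain H s b c a where H: "H \<subseteq> F" "H \<noteq> {}" and s: "strict_mono s"
    and us: "\<And>n. u (s n) = tcomb G H (b n)" and lim: "\<And>g. g \<in> H \<Longrightarrow> (\<lambda>n. b n g - c n) \<longlonglongrightarrow> a g"
    by (rule tcomb_compactness[where u = u, OF pts_nonempty[OF G] F(1) B gen]) (rule that)
  have finH: "finite H" and H\<Sigma>: "H \<subseteq> \<Sigma>" using F H finite_subset by blast+
  then have HPL: "H \<subseteq> PL G" using PL by blast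
  define f where "f = tcomb G H a"
  have f: "f \<in> \<Sigma>" unfolding f_def by (rule tsubmoduleD[OF tsub H\<Sigma> finH H(2)])
  have finT: "finite (Tv G x)" if "x \<in> pts G" for x
    using ss that by (auto simp: slope_structure_def dest: bij_betw_finite)
  have main: "real_of_int (D x) + divf G f x \<ge> real_of_int (E x) \<and> rho_v G r S ord P x f \<ge> E x"
    if x: "x \<in> pts G" for x
  proof (cases "x \<in> X")
    case False
    then have "E x = 0" by (simp add: X_def)
    moreover have "real_of_int (D x) + divf G f x \<ge> 0" using f RD x by (auto simp: RD_def)
    \<comment> \<open>A rank can be -1 when nothing lies above; \<open>f\<close> itself, through its
      index vector in the closure, rules this out.\<close>
    moreover have "int 1 - 1 \<le> rho_v G r S ord P x f"
      by (rule rho_v_ge[OF ss x \<eta>[OF x] comp[OF f], of "{f}"]) (use comp[OF f] in auto)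
    ultimately show ?thesis by simp
  next
    case True
    then have kE: "k x > 0" "E x = int (k x)" using Epos[of x] by (auto simp: k_def X_def)
    have div: "divf G (tcomb G H (b n)) (ray G (\<eta> x) (p x (s n) j)) \<ge> 1" if j: "j < k x" for n j
    proof -
      have i: "(x, j) \<in> I" using True j by (simp add: I_def)
      have qi: "q (s n) (x, j) = ray G (\<eta> x) (p x (s n) j)" by (simp add: q_def)
      have "q (s n) (x, j) \<in> pts G" using q i by blast
      then have "real_of_int (En (s n) (q (s n) (x, j))) \<le>
          real_of_int (D (q (s n) (x, j))) + divf G (u (s n)) (q (s n) (x, j))"
        using u(2) by (auto simp: bnrp_def)
      \<comment> \<open>With no contribution from \<open>D\<close>, the whole point must come from
        \<open>divf\<close>, that is, from a genuine break.\<close>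
      moreover have "D (q (s n) (x, j)) = 0" using D0[OF x, of "p x (s n) j"] p[OF x j, of "s n"] by (simp add: qi)
      moreover have "En (s n) (q (s n) (x, j)) \<ge> 1" unfolding En_def by (rule En(3)[OF i])
      ultimately show ?thesis by (simp add: us qi)
    qed
    have divx: "real_of_int (D x) + divf G (tcomb G H (b n)) x \<ge> 0" for n
      using u(1)[of "s n"] us[of n] RD x by (auto simp: RD_def)
    have uPL: "tcomb G H (b n) \<in> PL G" for n using u(1)[of "s n"] us[of n] PL by auto
    have lin': "g (ray G (\<eta> x) h) = g (ray G (\<eta> x) 0) + sl G g (\<eta> x) * h"
      if "g \<in> H" "0 \<le> h" "h \<le> \<delta> x" for g h using lin[OF x] H(1) that by blast
    have fPL: "tcomb G H a \<in> PL G" using f PL by (auto simp: f_def)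
    have p_lim': "(\<lambda>n. p x (s n) j) \<longlonglongrightarrow> 0" for j
      using LIMSEQ_subseq_LIMSEQ[OF p_lim s] by (simp add: o_def)
    note lp = limit_at_point[where p = "\<lambda>n. p x (s n)" and k = "k x", OF G finH H(2) HPL fPL \<eta>[OF x] finT[OF x] \<delta>[OF x]
        lin' int[OF x] lim uPL p[OF x] p_mono[OF x] p_lim' div divx kE(1)]
    have "int (Suc (k x)) - 1 \<le> rho_v G r S ord P x f"
    proof (rule rho_v_ge[OF ss x \<eta>[OF x] comp[OF f]])
      show "finite (active H a x)" using finH by (simp add: active_def)
      show "compatible G r S ord P g" if "g \<in> active H a x" for g
        using that H\<Sigma> comp by (auto simp: active_def)
      show "sl G f \<xi> \<le> sl G g \<xi>" if "g \<in> active H a x" "\<xi> \<in> Tv G x" for g \<xi>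
        unfolding f_def using sl_tcomb(1)[OF G finH H(2) HPL fPL that(2) that(1)] .
      show "Suc (k x) \<le> card ((\<lambda>g. sl G g (\<eta> x)) ` active H a x)" using lp(2) .
    qed
    then show ?thesis using lp(1) kE(2) by (simp add: f_def)
  qed
  then have "bnrp G D E f" "lrp G r S ord P E f" by (auto simp: bnrp_def lrp_def)
  then show ?thesis using f by blast
qed

theorem mainTheorem10:
  fixes G :: "('v, 'e) mgraph" and r :: nat
    and D :: "('v, 'e) pt \<Rightarrow> int" and \<Sigma> :: "(('v, 'e) pt \<Rightarrow> real) set"
  assumes "wf_mgraph G"
    and "effective G D"
    and "trop_lin_series G r D \<Sigma>"
  shows "structured G r \<Sigma> \<longleftrightarrow> comb_limit_lin_series G r D \<Sigma>"
proof
  assume "structured G r \<Sigma>"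
  then obtain V S ord P where ss: "slope_structure G r V S ord P" and RS: "\<Sigma> \<subseteq> RS G r S ord P"
    by (auto simp: structured_def)
  have tls: "divisor G D" "fin_gen G \<Sigma>" "tsubmodule G \<Sigma>" "\<Sigma> \<subseteq> RD G D" "all_dep G r \<Sigma>"
    using assms(3) by (auto simp: trop_lin_series_def)
  have "sup_closed G \<Sigma>"
    using tls by (intro fin_gen_sup_closed[OF assms(1)]) (auto simp: RD_def)
  moreover have "\<forall>E. effective G E \<and> deg E = int r \<longrightarrow> (\<exists>f\<in>\<Sigma>. bnrp G D E f \<and> lrp G r S ord P E f)"
    using structured_bnrp_lrp[OF assms(1,3) ss RS] by blast
  ultimately have "admissible G r D \<Sigma>"
    unfolding admissible_def using tls ss RS by blast
  then show "comb_limit_lin_series G r D \<Sigma>" using tls by (simp add: comb_limit_lin_series_def)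
next
  assume "comb_limit_lin_series G r D \<Sigma>"
  \<comment> \<open>Admissibility already includes a slope structure containing the series.\<close>
  then show "structured G r \<Sigma>"
    unfolding comb_limit_lin_series_def admissible_def structured_def by blast
qed

end
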